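(* Assume the following. (i) For each $n$, with $\psi(x,y)=\phi(x,y)+\gamma_nx^2$ and $\xi(\cdot,y)$ a subgradient of $\psi(\cdot,y)$, there exists a positive constant $L$ such that, for all $(x_1,x_2)\in\mathbb R^2$, $|\mathbb E(\xi(x_1,Y)-\xi(x_2,Y)\mid X)|\le L|x_1-x_2|$, where here $(X,Y)$ has the distribution $\mu_n=\frac1n\sum_{i=1}^n\delta_{(X_i,Y_i)}$. (ii) For all $p\ge0$ there exists a constant $\zeta(p)>0$ such that, for all $(x_1,x_2,y)\in\mathbb R^2\times\mathcal Y$ with $\max(|x_1|,|x_2|)\le p$, $$|\phi(x_1,y)-\phi(x_2,y)|\le\zeta(p)|x_1-x_2| .$$ (iii) $F^\star$ is bounded. (iv) $\mathrm{diam}(A^n(X))\to0$ in probability as $n\to\infty$, where $X$ has distribution $P$. Then, provided $\gamma_n\to0$, $N\to\infty$, $\frac{\log N}{nv_n}\to0$, and $$\frac{1}{\sqrt{nv_n\gamma_n}}\,\zeta\bigg(\sqrt{\frac{2\bar\phi}{v_n\gamma_n\inf_{\mathcal X}g}}\bigg)\to0,$$ we have $$\lim_{n\to\infty}\mathbb E\,A(\bar F_n)=A(F^\star).$$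
   Context: $\mathcal X$ is a compact subset of $\mathbb R^d$ and $\mathcal Y\subset\mathbb R$. The data $\mathcal D_n=\{(X_1,Y_1),\dots,(X_n,Y_n)\}$ are i.i.d. with values in $\mathcal X\times\mathcal Y$; $P_n$ is the empirical measure of $X_1,\dots,X_n$, and $P$ is the common distribution of the $X_i$. It is assumed that $P$ has a density $g$ with respect to Lebesgue measure $\lambda$ on $\mathbb R^d$ with $0<\inf_{\mathcal X}g\le\sup_{\mathcal X}g<\infty$. For each $n$, $\mathcal F_n$ is a finite class of simple functions on $\mathcal X$ with $\pm1$ values, together with the identically zero function, with $f\in\mathcal F_n\Leftrightarrow -f\in\mathcal F_n$. $\mathrm{lin}(\mathcal F_n)$ is the set of its linear combinations. There are an integer $N=N(n)\ge1$ and a partition of $\mathcal X$ into measurable sets $A_1^n,\dots,A_N^n$ such that any $F\in\mathrm{lin}(\mathcal F_n)$ takes the form $F=\sum_{j=1}^N\alpha_j\mathbf 1_{A_j^n}$, where $(\alpha_1,\dots,\alpha_N)\in\mathbb R^N$, and there is a positive sequence $(v_n)_n$ with $\min_{1\le j\le N}\lambda(A_j^n)\ge v_n$. Write $A^n(x)=A_j^n$ whenever $x\in A_j^n$, and $\mathrm{diam}(E)=\sup_{x,x'\in E}\|x-x'\|$ (Euclidean norm). The loss $\phi:\mathbb R\times\mathcal Y\to[0,\infty)$ is convex in its first argument and $\bar\phi:=\sup_{y\in\mathcal Y}\phi(0,y)<\infty$. $(\gamma_n)_n$ is a sequence of positive numbers. Set $$A_n(F)=\frac1n\sum_{i=1}^n\phi(F(X_i),Y_i),\qquad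 C_n(F)=A_n(F)+\gamma_n\|F\|_{P_n}^2,\qquad \|F\|_{P_n}^2=\frac1n\sum_{i=1}^nF(X_i)^2,$$ and let $\bar F_n=\arg\min_{F\in\mathrm{lin}(\mathcal F_n)}C_n(F)$ (a data-dependent function). For $F\in L^2(P)$, $A(F)=\mathbb E\,\phi(F(X_1),Y_1)$; the convex functional $A$ is assumed to be locally bounded on $L^2(P)$ (hence continuous), and $F^\star\in\arg\min_{F\in L^2(P)}A(F)$ denotes a minimizer (assumed to exist). $A(\bar F_n)$ means the functional $A$ evaluated at the random function $\bar F_n$, and $\mathbb E\,A(\bar F_n)$ is the expectation over the data.
   Formalization: The argmin is not unique on cells without observations, and arbitrary choices there make the claim false; the minimizer is taken to be 0 on such cells. Also, lin(F_n) is taken to be all step functions on the partition (with mere inclusion, F_n={0} is a counterexample). *)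

theory Defs
  imports "HOL-Probability.Probability"
begin

text \<open>
  Conventions. A real function on the compact set \<open>\<X>\<close> is represented by a function on
  \<open>real ^ 'd\<close> that vanishes outside \<open>\<X>\<close>. The loss \<open>\<phi>\<close> is written in curried form \<open>\<phi> x y\<close>; only
  its values for \<open>y \<in> \<Y>\<close> matter. Sample indices start at 1.
\<close>

definition lin :: "('b \<Rightarrow> real) set \<Rightarrow> ('b \<Rightarrow> real) set" where
  \<comment> \<open>intended for finite \<open>S\<close>\<close>
  "lin S = {F. \<exists>c. F = (\<lambda>x. \<Sum>f\<in>S. c f * f x)}"

definition step_functions :: "nat \<Rightarrow> (nat \<Rightarrow> 'b set) \<Rightarrow> ('b \<Rightarrow> real) set" where
  "step_functions k C = {F. \<exists>\<alpha>. F = (\<lambda>x. \<Sum>j=1..k. \<alpha> j * indicator (C j) x)}"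

definition cell :: "nat \<Rightarrow> (nat \<Rightarrow> 'b set) \<Rightarrow> 'b \<Rightarrow> 'b set" where
  \<comment> \<open>for a partition \<open>C 1, \<dots>, C k\<close>, this is the member containing \<open>x\<close>, and \<open>{}\<close> if there is none\<close>
  "cell k C x = \<Union>{C j | j. j \<in> {1..k} \<and> x \<in> C j}"

definition L2 :: "'b measure \<Rightarrow> ('b \<Rightarrow> real) set" where
  "L2 P = {F. F \<in> borel_measurable P \<and> integrable P (\<lambda>x. (F x)\<^sup>2)}"

definition L2_dist :: "'b measure \<Rightarrow> ('b \<Rightarrow> real) \<Rightarrow> ('b \<Rightarrow> real) \<Rightarrow> real" where
  "L2_dist P F G = sqrt (\<integral>x. (F x - G x)\<^sup>2 \<partial>P)"

definition locally_bounded_L2 :: "'b measure \<Rightarrow> (('b \<Rightarrow> real) \<Rightarrow> ennreal) \<Rightarrow> bool" where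
  "locally_bounded_L2 P \<Phi> \<longleftrightarrow>
     (\<forall>F\<in>L2 P. \<exists>\<epsilon>>0. \<exists>B::real. \<forall>G\<in>L2 P. L2_dist P G F < \<epsilon> \<longrightarrow> \<Phi> G \<le> ennreal B)"

text \<open>
  The loss is nonnegative, so its expectation is taken in \<open>[0, \<infinity>]\<close>; a Bochner integral would
  assign the value 0 to a non-integrable loss.
\<close>

definition risk ::
    "'a measure \<Rightarrow> (real \<Rightarrow> real \<Rightarrow> real) \<Rightarrow> ('a \<Rightarrow> 'b) \<Rightarrow> ('a \<Rightarrow> real) \<Rightarrow> ('b \<Rightarrow> real) \<Rightarrow> ennreal" where
  "risk M \<phi> X1 Y1 F = (\<integral>\<^sup>+\<omega>. ennreal (\<phi> (F (X1 \<omega>)) (Y1 \<omega>)) \<partial>M)"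

definition emp_risk ::
    "(real \<Rightarrow> real \<Rightarrow> real) \<Rightarrow> (nat \<Rightarrow> 'a \<Rightarrow> 'b) \<Rightarrow> (nat \<Rightarrow> 'a \<Rightarrow> real) \<Rightarrow> nat \<Rightarrow> 'a \<Rightarrow> ('b \<Rightarrow> real) \<Rightarrow> real"
  where
  "emp_risk \<phi> X Y n \<omega> F = (1 / real n) * (\<Sum>i=1..n. \<phi> (F (X i \<omega>)) (Y i \<omega>))"

definition emp_norm_sq :: "(nat \<Rightarrow> 'a \<Rightarrow> 'b) \<Rightarrow> nat \<Rightarrow> 'a \<Rightarrow> ('b \<Rightarrow> real) \<Rightarrow> real" where
  "emp_norm_sq X n \<omega> F = (1 / real n) * (\<Sum>i=1..n. (F (X i \<omega>))\<^sup>2)"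

definition pen_emp_risk ::
    "(real \<Rightarrow> real \<Rightarrow> real) \<Rightarrow> (nat \<Rightarrow> real) \<Rightarrow> (nat \<Rightarrow> 'a \<Rightarrow> 'b) \<Rightarrow> (nat \<Rightarrow> 'a \<Rightarrow> real) \<Rightarrow> nat \<Rightarrow> 'a \<Rightarrow>
      ('b \<Rightarrow> real) \<Rightarrow> real" where
  "pen_emp_risk \<phi> \<gamma> X Y n \<omega> F = emp_risk \<phi> X Y n \<omega> F + \<gamma> n * emp_norm_sq X n \<omega> F"

definition emp_measure ::
    "(nat \<Rightarrow> 'a \<Rightarrow> 'b) \<Rightarrow> (nat \<Rightarrow> 'a \<Rightarrow> real) \<Rightarrow> nat \<Rightarrow> 'a \<Rightarrow> ('b \<times> real) measure" where
  \<comment> \<open>the empirical measure \<open>\<mu>\<^sub>n\<close> of the data; meaningful for \<open>n \<ge> 1\<close>\<close>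
  "emp_measure X Y n \<omega> = measure_pmf (map_pmf (\<lambda>i. (X i \<omega>, Y i \<omega>)) (pmf_of_set {1..n}))"

definition emp_cond_exp ::
    "(nat \<Rightarrow> 'a \<Rightarrow> 'b::topological_space) \<Rightarrow> (nat \<Rightarrow> 'a \<Rightarrow> real) \<Rightarrow> nat \<Rightarrow> 'a \<Rightarrow> (real \<Rightarrow> real) \<Rightarrow>
      'b \<times> real \<Rightarrow> real" where
  \<comment> \<open>\<open>E(h(Y) | X)\<close> when \<open>(X, Y)\<close>, the pair of coordinate maps, has distribution \<open>\<mu>\<^sub>n\<close>\<close>
  "emp_cond_exp X Y n \<omega> h =
     real_cond_exp (emp_measure X Y n \<omega>) (vimage_algebra UNIV fst borel) (\<lambda>z. h (snd z))"

definition pen_loss :: "(real \<Rightarrow> real \<Rightarrow> real) \<Rightarrow> real \<Rightarrow> real \<Rightarrow> real \<Rightarrow> real" where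
  "pen_loss \<phi> c x y = \<phi> x y + c * x\<^sup>2"

definition is_subgradient :: "(real \<Rightarrow> real) \<Rightarrow> (real \<Rightarrow> real) \<Rightarrow> bool" where
  \<comment> \<open>\<open>s\<close> selects a subgradient of \<open>f\<close> at every point\<close>
  "is_subgradient f s \<longleftrightarrow> (\<forall>x z. f z \<ge> f x + s x * (z - x))"

text \<open>
  A minimizer of the penalized empirical risk over the linear span is determined only on the
  cells that contain a data point. The predictor is pinned down by the usual convention for
  partitioning estimates that it is 0 on the cells without observations; this makes it unique
  (for \<open>\<gamma> n > 0\<close>). Some such convention is needed: the value on an empty cell is otherwise
  arbitrary, although it enters the risk.
\<close>

definition is_predictor ::
    "(real \<Rightarrow> real \<Rightarrow> real) \<Rightarrow> (nat \<Rightarrow> real) \<Rightarrow> (nat \<Rightarrow> 'a \<Rightarrow> 'b) \<Rightarrow> (nat \<Rightarrow> 'a \<Rightarrow> real) \<Rightarrow>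
      ('b \<Rightarrow> real) set \<Rightarrow> nat \<Rightarrow> (nat \<Rightarrow> 'b set) \<Rightarrow> nat \<Rightarrow> 'a \<Rightarrow> ('b \<Rightarrow> real) \<Rightarrow> bool" where
  "is_predictor \<phi> \<gamma> X Y S k C n \<omega> F \<longleftrightarrow>
     is_arg_min (pen_emp_risk \<phi> \<gamma> X Y n \<omega>) (\<lambda>G. G \<in> lin S) F \<and>
     (\<forall>j\<in>{1..k}. (\<forall>i\<in>{1..n}. X i \<omega> \<notin> C j) \<longrightarrow> (\<forall>x\<in>C j. F x = 0))"

end

theory Submission
  imports Defs
begin

text \<open>
  The penalty makes the empirical problem strongly convex, and the problem splits over the
  partition: on each cell the estimator is the minimizer of a one-dimensional penalized sum, or 0
  if the cell contains no observation. The proof therefore rests on the stability of these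
  minimizers under deletion of one observation, and it needs no deviation bound that is uniform
  over \<open>lin (\<F> n)\<close>.

  Write \<open>c = \<gamma> n\<close>, let \<open>\<psi> x y = \<phi> x y + c * x\<^sup>2\<close> be the penalized loss, and let \<open>m\<close> be the supremum
  of \<open>\<phi> 0\<close> over \<open>\<Y>\<close>. Comparison with the value 0 shows that all cellwise minimizers lie in the
  ball of radius \<open>r = sqrt (m / c)\<close>; let \<open>L\<close> be a Lipschitz constant of the loss there, so that
  \<open>K = L + 2 * c * r\<close> is one for \<open>\<psi>\<close>. If a cell contains \<open>q\<close> observations and one of them is
  deleted, quadratic growth at the minimum (lemma \<open>quadratic_growth_at_minimum\<close>) forces the
  minimizer to move by at most \<open>K / (c * q)\<close>, and the penalized loss at the deleted observation
  rises by at most \<open>K\<^sup>2 / (c * q)\<close>. The sum of these increments over the cell is at most \<open>K\<^sup>2 / c\<close>,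
  whatever \<open>q\<close> is (lemma \<open>ridge_fit_leave_one_out\<close>), so the sum over all observations is at most
  \<open>N n * K\<^sup>2 / c\<close>.

  Take \<open>n + 1\<close> independent observations. By exchangeability the expected penalized loss of the
  estimator at a fresh point is the average of its leave-one-out losses. Since the minimizer for
  the full sample is at least as good as any competitor, every function \<open>F\<close> that is constant on
  the cells satisfies
  \<open>E \<psi> (Fbar X) Y \<le> E \<psi> (F X) Y + N n * K\<^sup>2 / (c * (n + 1))\<close>
  (lemma \<open>expected_pen_loss_cell_fit\<close>).

  The remainder vanishes: \<open>N n * v n\<close> is at most the volume of \<open>\<X>\<close>, so the remainder is of order
  \<open>L\<^sup>2 / (n * v n * \<gamma> n) + 1 / (n * v n)\<close>. For \<open>L\<close> one may take the value of \<open>\<zeta>\<close> that occurs in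
  the last limit condition, because \<open>v n * inf g \<le> 1\<close> bounds \<open>r\<close> by its argument; the second term
  tends to 0 since \<open>ln (N n)\<close> is eventually at least 1.

  It remains to choose \<open>F\<close>. As the diameter of the cell of a random point tends to 0 in
  probability, functions that are constant on the cells and obey the bound of \<open>Fstar\<close> approximate
  \<open>Fstar\<close> in \<open>L\<^sup>1(P)\<close> (lemma \<open>step_L1_approximation\<close>). On a fixed ball the loss is Lipschitz, hence
  their risks tend to that of \<open>Fstar\<close>, and their penalties vanish with \<open>\<gamma> n\<close>. The reverse
  inequality is the minimality of \<open>Fstar\<close>.
\<close>

section \<open>Penalized minimization in one variable\<close>

definition pen_sum :: "(real \<Rightarrow> real \<Rightarrow> real) \<Rightarrow> real \<Rightarrow> 'i set \<Rightarrow> ('i \<Rightarrow> real) \<Rightarrow> real \<Rightarrow> real" where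
  "pen_sum \<phi> c S y a = (\<Sum>i\<in>S. pen_loss \<phi> c a (y i))"

lemma pen_sum_eq:
  "pen_sum \<phi> c S y a = (\<Sum>i\<in>S. \<phi> a (y i)) + c * real (card S) * a\<^sup>2"
  by (simp add: pen_sum_def pen_loss_def sum.distrib algebra_simps)

lemma convex_on_sum_fun:
  assumes "\<And>i. i \<in> S \<Longrightarrow> convex_on C (f i)" "convex C"
  shows "convex_on C (\<lambda>x. \<Sum>i\<in>S. f i x :: real)"
  using assms
proof (induction S rule: infinite_finite_induct)
  case (insert i S)
  then show ?case by (simp add: convex_on_add)
qed (simp_all add: convex_on_def)

text \<open>
  The convex part lies below its chord on the segment from the minimizer \<open>a\<close> to \<open>b\<close>, while the
  square falls below its chord by \<open>c * t * (1 - t) * (b - a)\<^sup>2\<close> at parameter \<open>t\<close>. Minimality of \<open>a\<close>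
  leaves room for both only if the value at \<open>b\<close> is large; the bound follows as \<open>t\<close> tends to 0.
\<close>

lemma quadratic_growth_at_minimum:
  fixes k :: "real \<Rightarrow> real"
  assumes k: "convex_on UNIV k"
    and min: "\<And>x. k a + c * a\<^sup>2 \<le> k x + c * x\<^sup>2"
  shows "k a + c * a\<^sup>2 + c * (b - a)\<^sup>2 \<le> k b + c * b\<^sup>2"
proof -
  define h where "h x = k x + c * x\<^sup>2" for x
  have step: "c * (1 - t) * (b - a)\<^sup>2 \<le> h b - h a" if t: "0 < t" "t < 1" for t
  proof -
    have "k ((1 - t) * a + t * b) \<le> (1 - t) * k a + t * k b"
      using convex_onD[OF k, of t a b] t by simp
    with min[of "(1 - t) * a + t * b"]
    have "t * (c * (1 - t) * (b - a)\<^sup>2) \<le> t * (h b - h a)"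
      unfolding h_def by (simp add: power2_eq_square algebra_simps)
    with t show ?thesis by simp
  qed
  have "((\<lambda>t. c * (1 - t) * (b - a)\<^sup>2) \<longlongrightarrow> c * (1 - 0) * (b - a)\<^sup>2) (at_right 0)"
    by (intro tendsto_intros)
  moreover have "eventually (\<lambda>t. c * (1 - t) * (b - a)\<^sup>2 \<le> h b - h a) (at_right 0)"
    using step by (auto simp: eventually_at_right_field intro!: exI[of _ 1])
  ultimately have "c * (1 - 0) * (b - a)\<^sup>2 \<le> h b - h a"
    by (rule tendsto_upperbound) simp
  then show ?thesis by (simp add: h_def)
qed

lemma pen_sum_growth:
  assumes "\<And>i. i \<in> S \<Longrightarrow> convex_on UNIV (\<lambda>x. \<phi> x (y i))"
    and "\<And>x. pen_sum \<phi> c S y a \<le> pen_sum \<phi> c S y x"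
  shows "pen_sum \<phi> c S y a + c * real (card S) * (b - a)\<^sup>2 \<le> pen_sum \<phi> c S y b"
  using quadratic_growth_at_minimum[of "\<lambda>x. \<Sum>i\<in>S. \<phi> x (y i)" a "c * real (card S)" b]
    convex_on_sum_fun[of S UNIV "\<lambda>i x. \<phi> x (y i)"] assms
  by (simp add: pen_sum_eq)

text \<open>
  The loss is nonnegative, so already the penalty of \<open>a\<close> is at most the objective at 0. The sample
  size cancels, which is why the bound does not depend on the number of points in a cell.
\<close>

lemma pen_sum_minimizer_bound:
  assumes S: "finite S" "S \<noteq> {}" and c: "c > 0"
    and nonneg: "\<And>i. i \<in> S \<Longrightarrow> \<phi> a (y i) \<ge> 0"
    and bdd: "\<And>i. i \<in> S \<Longrightarrow> \<phi> 0 (y i) \<le> m"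
    and le: "pen_sum \<phi> c S y a \<le> pen_sum \<phi> c S y 0"
  shows "\<bar>a\<bar> \<le> sqrt (m / c)"
proof -
  have "c * real (card S) * a\<^sup>2 \<le> pen_sum \<phi> c S y a"
    using sum_nonneg[of S "\<lambda>i. \<phi> a (y i)"] nonneg by (simp add: pen_sum_eq)
  also note le
  also have "pen_sum \<phi> c S y 0 \<le> real (card S) * m"
    using sum_bounded_above[of S "\<lambda>i. \<phi> 0 (y i)" m] bdd by (simp add: pen_sum_eq)
  finally have "real (card S) * (c * a\<^sup>2) \<le> real (card S) * m" by (simp add: algebra_simps)
  moreover have "real (card S) > 0" using S by (simp add: card_gt_0_iff)
  ultimately have "c * a\<^sup>2 \<le> m" by simp
  then have "a\<^sup>2 \<le> m / c" using c by (simp add: field_simps)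
  then show ?thesis by (rule real_le_rsqrt[of "\<bar>a\<bar>", simplified])
qed

text \<open>
  By the bound above, a point outside \<open>[-sqrt (m / c), sqrt (m / c)]\<close> cannot beat 0, and on this
  interval the continuous objective attains its minimum.
\<close>

lemma pen_sum_minimizer_exists:
  assumes S: "finite S" "S \<noteq> {}" and c: "c > 0"
    and convex: "\<And>i. i \<in> S \<Longrightarrow> convex_on UNIV (\<lambda>x. \<phi> x (y i))"
    and nonneg: "\<And>i x. i \<in> S \<Longrightarrow> \<phi> x (y i) \<ge> 0"
  shows "\<exists>a. \<forall>b. pen_sum \<phi> c S y a \<le> pen_sum \<phi> c S y b"
proof -
  define m where "m = Max ((\<lambda>i. \<phi> 0 (y i)) ` S)"
  have m: "\<phi> 0 (y i) \<le> m" if "i \<in> S" for i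
    unfolding m_def using S that by (intro Max_ge) auto
  define B where "B = sqrt (m / c)"
  obtain i where "i \<in> S" using S by auto
  then have "m \<ge> 0" using m[of i] nonneg[of i 0] by linarith
  then have B: "B \<ge> 0" using c by (simp add: B_def)
  have "continuous_on UNIV (\<lambda>x. \<Sum>i\<in>S. \<phi> x (y i))"
    by (intro convex_on_continuous convex_on_sum_fun convex) auto
  then have "continuous_on {-B..B} (\<lambda>x. (\<Sum>i\<in>S. \<phi> x (y i)) + c * real (card S) * x\<^sup>2)"
    by (rule continuous_on_add[OF continuous_on_subset]) (auto intro!: continuous_intros)
  then have "continuous_on {-B..B} (pen_sum \<phi> c S y)"
    by (simp add: pen_sum_eq[abs_def])
  then obtain a where a: "a \<in> {-B..B}" "\<And>b. b \<in> {-B..B} \<Longrightarrow> pen_sum \<phi> c S y a \<le> pen_sum \<phi> c S y b"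
    using continuous_attains_inf[of "{-B..B}" "pen_sum \<phi> c S y"] B by auto
  have "pen_sum \<phi> c S y a \<le> pen_sum \<phi> c S y b" for b
  proof (cases "pen_sum \<phi> c S y b \<le> pen_sum \<phi> c S y 0")
    case True
    then have "\<bar>b\<bar> \<le> B" unfolding B_def using S c nonneg m by (intro pen_sum_minimizer_bound)
    then show ?thesis using a by (auto simp: abs_le_iff)
  next
    case False
    then show ?thesis using a(2)[of 0] B by auto
  qed
  then show ?thesis by blast
qed

text \<open>
  For empty \<open>S\<close> every point is a minimizer. The value 0 is the convention for cells without
  observations; \<open>ridge_fit_minimizes\<close> and \<open>ridge_fit_bound\<close> hold for it as well, so the stability
  estimate needs no separate treatment of cells that contain a single observation.
\<close>

definition ridge_fit :: "(real \<Rightarrow> real \<Rightarrow> real) \<Rightarrow> real \<Rightarrow> 'i set \<Rightarrow> ('i \<Rightarrow> real) \<Rightarrow> real" where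
  "ridge_fit \<phi> c S y =
     (if S = {} then 0 else THE a. \<forall>b. pen_sum \<phi> c S y a \<le> pen_sum \<phi> c S y b)"

lemma ridge_fit_eqI:
  assumes S: "finite S" "S \<noteq> {}" and c: "c > 0"
    and convex: "\<And>i. i \<in> S \<Longrightarrow> convex_on UNIV (\<lambda>x. \<phi> x (y i))"
    and a: "\<And>b. pen_sum \<phi> c S y a \<le> pen_sum \<phi> c S y b"
  shows "ridge_fit \<phi> c S y = a"
proof -
  have "a' = a" if "\<forall>b. pen_sum \<phi> c S y a' \<le> pen_sum \<phi> c S y b" for a'
  proof -
    have "pen_sum \<phi> c S y a + c * real (card S) * (a' - a)\<^sup>2 \<le> pen_sum \<phi> c S y a'"
      by (rule pen_sum_growth[OF convex a])
    also have "\<dots> \<le> pen_sum \<phi> c S y a" using that by blast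
    finally have "c * real (card S) * (a' - a)\<^sup>2 \<le> 0" by simp
    moreover have "c * real (card S) > 0" using S c by (simp add: card_gt_0_iff)
    ultimately have "(a' - a)\<^sup>2 \<le> 0" by (metis linorder_not_less mult_pos_pos)
    then show ?thesis by simp
  qed
  then show ?thesis unfolding ridge_fit_def using S a by (auto intro!: the_equality)
qed

lemma ridge_fit_minimizes:
  assumes S: "finite S" and c: "c > 0"
    and convex: "\<And>i. i \<in> S \<Longrightarrow> convex_on UNIV (\<lambda>x. \<phi> x (y i))"
    and nonneg: "\<And>i x. i \<in> S \<Longrightarrow> \<phi> x (y i) \<ge> 0"
  shows "pen_sum \<phi> c S y (ridge_fit \<phi> c S y) \<le> pen_sum \<phi> c S y b"
proof (cases "S = {}")
  case True
  then show ?thesis by (simp add: pen_sum_def)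
next
  case False
  then obtain a where "\<forall>b. pen_sum \<phi> c S y a \<le> pen_sum \<phi> c S y b"
    using pen_sum_minimizer_exists[of S c \<phi> y] S c convex nonneg by blast
  then show ?thesis using ridge_fit_eqI[of S c \<phi> y a] S False c convex by auto
qed

lemma ridge_fit_bound:
  assumes S: "finite S" and c: "c > 0"
    and convex: "\<And>i. i \<in> S \<Longrightarrow> convex_on UNIV (\<lambda>x. \<phi> x (y i))"
    and nonneg: "\<And>i x. i \<in> S \<Longrightarrow> \<phi> x (y i) \<ge> 0"
    and bdd: "\<And>i. i \<in> S \<Longrightarrow> \<phi> 0 (y i) \<le> m" and m: "m \<ge> 0"
  shows "\<bar>ridge_fit \<phi> c S y\<bar> \<le> sqrt (m / c)"
proof (cases "S = {}")
  case True
  then show ?thesis using m c by (simp add: ridge_fit_def)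
next
  case False
  then show ?thesis using assms ridge_fit_minimizes[of S c \<phi> y]
    by (intro pen_sum_minimizer_bound[of S c \<phi> _ y]) auto
qed

text \<open>
  This expresses the position of the minimizer by countably many comparisons of objective values,
  which makes it measurable as a function of the data. By strict convexity the objective decreases
  up to the minimizer and increases after it: a point to the left of \<open>t\<close> that is not worse than
  \<open>t\<close> exists iff the minimizer lies to the left of \<open>t\<close>.
\<close>

lemma ridge_fit_less_iff:
  assumes S: "finite S" "S \<noteq> {}" and c: "c > 0"
    and convex: "\<And>i. i \<in> S \<Longrightarrow> convex_on UNIV (\<lambda>x. \<phi> x (y i))"
    and nonneg: "\<And>i x. i \<in> S \<Longrightarrow> \<phi> x (y i) \<ge> 0"
  shows "ridge_fit \<phi> c S y < t \<longleftrightarrow>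
    (\<exists>s\<in>\<rat>. s < t \<and> pen_sum \<phi> c S y s \<le> pen_sum \<phi> c S y t)"
proof -
  define h where "h = pen_sum \<phi> c S y"
  define a where "a = ridge_fit \<phi> c S y"
  have pos: "c * real (card S) > 0" using S c by (simp add: card_gt_0_iff)
  have conv: "convex_on UNIV h"
  proof -
    have "convex_on UNIV (\<lambda>x::real. c * real (card S) * x\<^sup>2)"
      using convex_on_cmul[of "c * real (card S)" UNIV "\<lambda>x. x\<^sup>2"] pos convex_power2 by simp
    then have "convex_on UNIV (\<lambda>x. (\<Sum>i\<in>S. \<phi> x (y i)) + c * real (card S) * x\<^sup>2)"
      by (intro convex_on_add convex_on_sum_fun convex) auto
    then show ?thesis unfolding h_def by (simp add: pen_sum_eq[abs_def])
  qed
  have min: "h a \<le> h x" for x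
    unfolding h_def a_def by (rule ridge_fit_minimizes) (use S c convex nonneg in auto)
  have strict: "h a < h x" if "x \<noteq> a" for x
  proof -
    have "h a + c * real (card S) * (x - a)\<^sup>2 \<le> h x"
      unfolding h_def by (intro pen_sum_growth convex) (use min h_def in auto)
    moreover have "c * real (card S) * (x - a)\<^sup>2 > 0" using pos that by simp
    ultimately show ?thesis by linarith
  qed
  show ?thesis unfolding h_def[symmetric] a_def[symmetric]
  proof safe
    assume "a < t"
    then obtain s where s: "s \<in> \<rat>" "a < s" "s < t" using Rats_dense_in_real by blast
    define u where "u = (s - a) / (t - a)"
    have u: "0 < u" "u < 1" using s by (auto simp: u_def)
    have "s = a + u * (t - a)" using s by (simp add: u_def)
    then have "s = (1 - u) * a + u * t" by (simp add: algebra_simps)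
    then have "h s \<le> (1 - u) * h a + u * h t"
      using convex_onD[OF conv, of u a t] u by simp
    also have "\<dots> \<le> (1 - u) * h t + u * h t"
      using u min[of t] by (intro add_right_mono mult_left_mono) auto
    finally have "h s \<le> h t" by (simp add: algebra_simps)
    then show "\<exists>s\<in>\<rat>. s < t \<and> h s \<le> h t" using s by auto
  next
    fix s assume s: "s < t" "h s \<le> h t"
    show "a < t"
    proof (rule ccontr)
      assume "\<not> a < t"
      then have ta: "t \<le> a" by simp
      define u where "u = (t - s) / (a - s)"
      have u: "0 < u" "u \<le> 1" using s ta by (auto simp: u_def)
      have "t = s + u * (a - s)" using s ta by (simp add: u_def)
      then have "t = (1 - u) * s + u * a" by (simp add: algebra_simps)
      then have "h t \<le> (1 - u) * h s + u * h a"
        using convex_onD[OF conv, of u s a] u by simp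
      also have "\<dots> < (1 - u) * h s + u * h s" using strict[of s] s ta u by simp
      finally show False using s by (simp add: algebra_simps)
    qed
  qed
qed

text \<open>
  Let \<open>q = card T\<close>. The two objectives differ by the penalized loss at \<open>i\<close>. Adding the quadratic
  growth of the full objective at \<open>a\<close> to that of the reduced one at \<open>b\<close>, everything else cancels:
  the increment is at least \<open>c * (2 * q - 1) * (b - a)\<^sup>2 \<ge> c * q * (b - a)\<^sup>2\<close>. Being at most
  \<open>K * \<bar>b - a\<bar>\<close>, it forces \<open>\<bar>b - a\<bar> \<le> K / (c * q)\<close>, and the Lipschitz bound gives the claim.
\<close>

lemma leave_one_out_increment:
  assumes T: "finite T" "i \<in> T" and c: "c > 0"
    and convex: "\<And>j. j \<in> T \<Longrightarrow> convex_on UNIV (\<lambda>x. \<phi> x (y j))"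
    and a: "\<And>x. pen_sum \<phi> c T y a \<le> pen_sum \<phi> c T y x"
    and b: "\<And>x. pen_sum \<phi> c (T - {i}) y b \<le> pen_sum \<phi> c (T - {i}) y x"
    and lip: "pen_loss \<phi> c b (y i) - pen_loss \<phi> c a (y i) \<le> K * \<bar>b - a\<bar>"
  shows "pen_loss \<phi> c b (y i) - pen_loss \<phi> c a (y i) \<le> K\<^sup>2 / (c * real (card T))"
proof (cases "a = b")
  case True
  then show ?thesis using c by simp
next
  case False
  define t where "t = \<bar>b - a\<bar>"
  define d where "d = pen_loss \<phi> c b (y i) - pen_loss \<phi> c a (y i)"
  define m where "m = real (card T)"
  have t: "t > 0" using False by (simp add: t_def)
  have cT: "real (card (T - {i})) = m - 1" and m: "m \<ge> 1"
    using T card_gt_0_iff[of T] by (auto simp: m_def of_nat_diff)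
  have split: "pen_sum \<phi> c T y x = pen_loss \<phi> c x (y i) + pen_sum \<phi> c (T - {i}) y x" for x
    unfolding pen_sum_def using T by (simp add: sum.remove)
  have "pen_sum \<phi> c T y a + c * m * (b - a)\<^sup>2 \<le> pen_sum \<phi> c T y b"
    unfolding m_def by (rule pen_sum_growth[OF convex a])
  moreover have "pen_sum \<phi> c (T - {i}) y b + c * (m - 1) * (a - b)\<^sup>2 \<le> pen_sum \<phi> c (T - {i}) y a"
    unfolding cT[symmetric] by (rule pen_sum_growth[OF convex b]) auto
  ultimately have "c * m * t\<^sup>2 + c * (m - 1) * t\<^sup>2 \<le> d"
    unfolding split d_def t_def by (simp add: power2_commute)
  moreover have "c * (m - 1) * t\<^sup>2 \<ge> 0" using c m by simp
  ultimately have "c * m * t\<^sup>2 \<le> d" by linarith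
  also have d: "d \<le> K * t" using lip by (simp add: d_def t_def)
  finally have "t * (c * m * t) \<le> t * K" by (simp add: power2_eq_square algebra_simps)
  then have cmt: "c * m * t \<le> K" using t by simp
  have cm: "c * m > 0" using c m by simp
  then have "0 < c * m * t" using t by simp
  then have "K * (c * m * t) \<le> K * K" using cmt by (intro mult_left_mono) linarith+
  then have "K * t \<le> K\<^sup>2 / (c * m)" using cm by (simp add: field_simps power2_eq_square)
  with d show ?thesis by (simp add: d_def m_def)
qed

lemma pen_loss_lipschitz:
  assumes "\<bar>\<phi> b w - \<phi> a w\<bar> \<le> L * \<bar>b - a\<bar>" "\<bar>a\<bar> \<le> B" "\<bar>b\<bar> \<le> B" "c > 0"
  shows "pen_loss \<phi> c b w - pen_loss \<phi> c a w \<le> (L + 2 * c * B) * \<bar>b - a\<bar>"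
proof -
  have "b\<^sup>2 - a\<^sup>2 \<le> \<bar>b + a\<bar> * \<bar>b - a\<bar>"
    by (metis abs_ge_self abs_mult power2_commute square_diff_square_factored power2_eq_square)
  also have "\<dots> \<le> (2 * B) * \<bar>b - a\<bar>" using assms by (intro mult_right_mono) auto
  finally have "c * (b\<^sup>2 - a\<^sup>2) \<le> c * ((2 * B) * \<bar>b - a\<bar>)" using assms by (intro mult_left_mono) auto
  then show ?thesis using assms(1) by (simp add: pen_loss_def algebra_simps)
qed

text \<open>
  Each of the \<open>card T\<close> increments is at most \<open>K\<^sup>2 / (c * card T)\<close>, so their sum does not depend on the
  size of \<open>T\<close>. The full-sample minimizer is then replaced by an arbitrary competitor \<open>\<alpha>\<close>.
\<close>

lemma ridge_fit_leave_one_out: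
  assumes T: "finite T" and c: "c > 0"
    and convex: "\<And>i. i \<in> T \<Longrightarrow> convex_on UNIV (\<lambda>x. \<phi> x (y i))"
    and nonneg: "\<And>i x. i \<in> T \<Longrightarrow> \<phi> x (y i) \<ge> 0"
    and bdd: "\<And>i. i \<in> T \<Longrightarrow> \<phi> 0 (y i) \<le> m" and m: "m \<ge> 0"
    and lip: "\<And>i a b. \<lbrakk>i \<in> T; \<bar>a\<bar> \<le> sqrt (m / c); \<bar>b\<bar> \<le> sqrt (m / c)\<rbrakk>
                \<Longrightarrow> \<bar>\<phi> b (y i) - \<phi> a (y i)\<bar> \<le> L * \<bar>b - a\<bar>"
  shows "(\<Sum>i\<in>T. pen_loss \<phi> c (ridge_fit \<phi> c (T - {i}) y) (y i))
           \<le> pen_sum \<phi> c T y \<alpha> + (L + 2 * c * sqrt (m / c))\<^sup>2 / c"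
proof (cases "T = {}")
  case True
  then show ?thesis using c by (simp add: pen_sum_def)
next
  case False
  define a where "a = ridge_fit \<phi> c T y"
  define K where "K = L + 2 * c * sqrt (m / c)"
  have mT: "real (card T) > 0" using False T by (simp add: card_gt_0_iff)
  have "pen_loss \<phi> c (ridge_fit \<phi> c (T - {i}) y) (y i) - pen_loss \<phi> c a (y i)
          \<le> K\<^sup>2 / (c * real (card T))" if i: "i \<in> T" for i
    unfolding a_def
  proof (rule leave_one_out_increment[where a = "ridge_fit \<phi> c T y"])
    show "pen_sum \<phi> c T y (ridge_fit \<phi> c T y) \<le> pen_sum \<phi> c T y x" for x
      using assms by (intro ridge_fit_minimizes) auto
    show "pen_sum \<phi> c (T - {i}) y (ridge_fit \<phi> c (T - {i}) y) \<le> pen_sum \<phi> c (T - {i}) y x" for x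
      using assms by (intro ridge_fit_minimizes) auto
    show "pen_loss \<phi> c (ridge_fit \<phi> c (T - {i}) y) (y i) - pen_loss \<phi> c (ridge_fit \<phi> c T y) (y i)
      \<le> K * \<bar>ridge_fit \<phi> c (T - {i}) y - ridge_fit \<phi> c T y\<bar>"
      unfolding K_def using assms i by (intro pen_loss_lipschitz lip ridge_fit_bound) auto
  qed (use T i c convex in auto)
  then have "(\<Sum>i\<in>T. pen_loss \<phi> c (ridge_fit \<phi> c (T - {i}) y) (y i))
      \<le> (\<Sum>i\<in>T. pen_loss \<phi> c a (y i) + K\<^sup>2 / (c * real (card T)))"
    by (intro sum_mono) (simp add: algebra_simps)
  also have "\<dots> = pen_sum \<phi> c T y a + K\<^sup>2 / c"
    using mT by (simp add: sum.distrib pen_sum_def)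
  also have "pen_sum \<phi> c T y a \<le> pen_sum \<phi> c T y \<alpha>"
    unfolding a_def using assms by (intro ridge_fit_minimizes) auto
  finally show ?thesis by (simp add: K_def)
qed

section \<open>Cellwise fits and their expected loss\<close>

lemma ridge_fit_reindex:
  assumes "inj_on \<tau> S" "\<And>i. i \<in> S \<Longrightarrow> y' i = y (\<tau> i)"
  shows "ridge_fit \<phi> c S y' = ridge_fit \<phi> c (\<tau> ` S) y"
proof -
  have "pen_sum \<phi> c S y' = pen_sum \<phi> c (\<tau> ` S) y"
    using assms by (auto simp: pen_sum_def sum.reindex fun_eq_iff intro!: sum.cong)
  then show ?thesis by (simp add: ridge_fit_def)
qed

text \<open>
  Only the cell \<open>\<kappa> w\<close> and the label \<open>\<eta> w\<close> of an observation \<open>w\<close> enter the estimator, so the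
  sample space is left abstract. The index set \<open>S\<close> is a parameter because the estimator is
  compared with its leave-one-out versions.
\<close>

definition cell_fit ::
    "(real \<Rightarrow> real \<Rightarrow> real) \<Rightarrow> real \<Rightarrow> ('z \<Rightarrow> nat) \<Rightarrow> ('z \<Rightarrow> real) \<Rightarrow> 'i set \<Rightarrow> ('i \<Rightarrow> 'z) \<Rightarrow> nat \<Rightarrow> real"
  where
  "cell_fit \<phi> c \<kappa> \<eta> S z q = ridge_fit \<phi> c {i \<in> S. \<kappa> (z i) = q} (\<lambda>i. \<eta> (z i))"

text \<open>
  The fit depends only on the family of observations, not on their order. This is what
  exchangeability acts on.
\<close>

lemma cell_fit_reindex:
  assumes "inj_on \<tau> S" "\<And>i. i \<in> S \<Longrightarrow> z' i = z (\<tau> i)"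
  shows "cell_fit \<phi> c \<kappa> \<eta> S z' q = cell_fit \<phi> c \<kappa> \<eta> (\<tau> ` S) z q"
proof -
  have "{i \<in> \<tau> ` S. \<kappa> (z i) = q} = \<tau> ` {i \<in> S. \<kappa> (z' i) = q}"
    using assms(2) by auto
  then show ?thesis
    unfolding cell_fit_def using assms
    by (simp only:) (auto intro!: ridge_fit_reindex inj_on_subset[OF assms(1)])
qed

lemma cell_fit_leave_one_out:
  assumes I: "finite I" and c: "c > 0" and \<phi>bar: "\<phi>bar \<ge> 0"
    and \<kappa>: "\<And>i. i \<in> I \<Longrightarrow> \<kappa> (z i) \<in> {1..k}"
    and convex: "\<And>i. i \<in> I \<Longrightarrow> convex_on UNIV (\<lambda>x. \<phi> x (\<eta> (z i)))"
    and nonneg: "\<And>i x. i \<in> I \<Longrightarrow> \<phi> x (\<eta> (z i)) \<ge> 0"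
    and bdd: "\<And>i. i \<in> I \<Longrightarrow> \<phi> 0 (\<eta> (z i)) \<le> \<phi>bar"
    and lip: "\<And>i a b. \<lbrakk>i \<in> I; \<bar>a\<bar> \<le> sqrt (\<phi>bar / c); \<bar>b\<bar> \<le> sqrt (\<phi>bar / c)\<rbrakk>
                \<Longrightarrow> \<bar>\<phi> b (\<eta> (z i)) - \<phi> a (\<eta> (z i))\<bar> \<le> L * \<bar>b - a\<bar>"
  shows "(\<Sum>i\<in>I. pen_loss \<phi> c (cell_fit \<phi> c \<kappa> \<eta> (I - {i}) z (\<kappa> (z i))) (\<eta> (z i)))
    \<le> (\<Sum>i\<in>I. pen_loss \<phi> c (\<alpha> (\<kappa> (z i))) (\<eta> (z i))) + real k * ((L + 2 * c * sqrt (\<phi>bar / c))\<^sup>2 / c)"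
proof -
  define T where "T q = {i \<in> I. \<kappa> (z i) = q}" for q
  have group: "(\<Sum>i\<in>I. h i) = (\<Sum>q\<in>{1..k}. \<Sum>i\<in>T q. h i)" for h :: "_ \<Rightarrow> real"
    unfolding T_def by (rule sum.group[symmetric]) (use I \<kappa> in auto)
  have "(\<Sum>i\<in>T q. pen_loss \<phi> c (cell_fit \<phi> c \<kappa> \<eta> (I - {i}) z (\<kappa> (z i))) (\<eta> (z i)))
      \<le> (\<Sum>i\<in>T q. pen_loss \<phi> c (\<alpha> (\<kappa> (z i))) (\<eta> (z i))) + (L + 2 * c * sqrt (\<phi>bar / c))\<^sup>2 / c"
    for q
  proof -
    have "(\<Sum>i\<in>T q. pen_loss \<phi> c (cell_fit \<phi> c \<kappa> \<eta> (I - {i}) z (\<kappa> (z i))) (\<eta> (z i)))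
        = (\<Sum>i\<in>T q. pen_loss \<phi> c (ridge_fit \<phi> c (T q - {i}) (\<lambda>i. \<eta> (z i))) (\<eta> (z i)))"
    proof (rule sum.cong[OF refl])
      fix i assume "i \<in> T q"
      then have "{j \<in> I - {i}. \<kappa> (z j) = \<kappa> (z i)} = T q - {i}" by (auto simp: T_def)
      then show "pen_loss \<phi> c (cell_fit \<phi> c \<kappa> \<eta> (I - {i}) z (\<kappa> (z i))) (\<eta> (z i))
        = pen_loss \<phi> c (ridge_fit \<phi> c (T q - {i}) (\<lambda>i. \<eta> (z i))) (\<eta> (z i))"
        by (simp add: cell_fit_def)
    qed
    also have "\<dots> \<le> pen_sum \<phi> c (T q) (\<lambda>i. \<eta> (z i)) (\<alpha> q) + (L + 2 * c * sqrt (\<phi>bar / c))\<^sup>2 / c"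
      by (rule ridge_fit_leave_one_out[where m = \<phi>bar]) (use assms in \<open>auto simp: T_def\<close>)
    also have "pen_sum \<phi> c (T q) (\<lambda>i. \<eta> (z i)) (\<alpha> q)
        = (\<Sum>i\<in>T q. pen_loss \<phi> c (\<alpha> (\<kappa> (z i))) (\<eta> (z i)))"
      unfolding pen_sum_def by (rule sum.cong) (auto simp: T_def)
    finally show ?thesis .
  qed
  then have "(\<Sum>q\<in>{1..k}. \<Sum>i\<in>T q. pen_loss \<phi> c (cell_fit \<phi> c \<kappa> \<eta> (I - {i}) z (\<kappa> (z i))) (\<eta> (z i)))
    \<le> (\<Sum>q\<in>{1..k}. (\<Sum>i\<in>T q. pen_loss \<phi> c (\<alpha> (\<kappa> (z i))) (\<eta> (z i))) + (L + 2 * c * sqrt (\<phi>bar / c))\<^sup>2 / c)"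
    by (intro sum_mono) auto
  then show ?thesis unfolding group by (simp add: sum.distrib)
qed

lemma cell_fit_measurable:
  assumes I: "finite S" "S \<subseteq> I" and c: "c > 0"
    and \<kappa>[measurable]: "\<kappa> \<in> measurable D (count_space UNIV)"
    and meas: "\<And>s. (\<lambda>w. \<phi> s (\<eta> w)) \<in> borel_measurable D"
    and convex: "\<And>w. w \<in> space D \<Longrightarrow> convex_on UNIV (\<lambda>x. \<phi> x (\<eta> w))"
    and nonneg: "\<And>w x. w \<in> space D \<Longrightarrow> \<phi> x (\<eta> w) \<ge> 0"
  shows "(\<lambda>z. cell_fit \<phi> c \<kappa> \<eta> S z q) \<in> borel_measurable (Pi\<^sub>M I (\<lambda>_. D))"
proof (rule borel_measurableI_less)
  fix t :: real
  let ?P = "Pi\<^sub>M I (\<lambda>_. D)"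
  define obj where "obj s z = (\<Sum>i\<in>S. if \<kappa> (z i) = q then pen_loss \<phi> c s (\<eta> (z i)) else 0)" for s z
  have pl[measurable]: "(\<lambda>w. pen_loss \<phi> c s (\<eta> w)) \<in> borel_measurable D" for s
    unfolding pen_loss_def using meas by measurable
  have comp[measurable]: "(\<lambda>z. z i) \<in> measurable ?P D" if "i \<in> S" for i
    using that I by (intro measurable_component_singleton) auto
  have obj_meas: "obj s \<in> borel_measurable ?P" for s
  proof -
    have "(\<lambda>z. if \<kappa> (z i) = q then pen_loss \<phi> c s (\<eta> (z i)) else 0) \<in> borel_measurable ?P"
      if "i \<in> S" for i
    proof -
      have [measurable]: "(\<lambda>z. pen_loss \<phi> c s (\<eta> (z i))) \<in> borel_measurable ?P"
        "(\<lambda>z. \<kappa> (z i)) \<in> measurable ?P (count_space UNIV)"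
        using measurable_compose[OF comp[OF that] pl] measurable_compose[OF comp[OF that] \<kappa>] by auto
      show ?thesis by measurable
    qed
    then show ?thesis unfolding obj_def by (intro borel_measurable_sum)
  qed
  have obj: "pen_sum \<phi> c {i \<in> S. \<kappa> (z i) = q} (\<lambda>i. \<eta> (z i)) s = obj s z" for s z
    unfolding pen_sum_def obj_def using I by (simp add: sum.inter_filter)
  have occ[measurable]: "Measurable.pred ?P (\<lambda>z. \<exists>i\<in>S. \<kappa> (z i) = q)"
  proof -
    have "Measurable.pred ?P (\<lambda>z. \<kappa> (z i) = q)" if "i \<in> S" for i
      using measurable_compose[OF comp[OF that] \<kappa>] by measurable
    then show ?thesis using I by (intro pred_intros_finite) auto
  qed
  have eq: "{z \<in> space ?P. cell_fit \<phi> c \<kappa> \<eta> S z q < t}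
     = {z \<in> space ?P. ((\<not> (\<exists>i\<in>S. \<kappa> (z i) = q)) \<and> 0 < t) \<or>
          ((\<exists>i\<in>S. \<kappa> (z i) = q) \<and> (\<exists>s\<in>\<rat>. s < t \<and> obj s z \<le> obj t z))}"
  proof (intro Collect_cong conj_cong refl)
    fix z assume z: "z \<in> space ?P"
    then have zD: "z i \<in> space D" if "i \<in> S" for i
      using that I by (auto simp: space_PiM)
    show "cell_fit \<phi> c \<kappa> \<eta> S z q < t \<longleftrightarrow> ((\<not> (\<exists>i\<in>S. \<kappa> (z i) = q)) \<and> 0 < t) \<or>
          ((\<exists>i\<in>S. \<kappa> (z i) = q) \<and> (\<exists>s\<in>\<rat>. s < t \<and> obj s z \<le> obj t z))"
    proof (cases "\<exists>i\<in>S. \<kappa> (z i) = q")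
      case False
      then have "{i \<in> S. \<kappa> (z i) = q} = {}" by auto
      then show ?thesis using False by (simp add: cell_fit_def ridge_fit_def)
    next
      case True
      then have "cell_fit \<phi> c \<kappa> \<eta> S z q < t \<longleftrightarrow> (\<exists>s\<in>\<rat>. s < t \<and> obj s z \<le> obj t z)"
        unfolding cell_fit_def obj[symmetric]
        by (intro ridge_fit_less_iff) (use c I convex nonneg zD in auto)
      with True show ?thesis by blast
    qed
  qed
  have [measurable]: "Measurable.pred ?P (\<lambda>z. \<exists>s\<in>\<rat>. s < t \<and> obj s z \<le> obj t z)"
  proof -
    have "(\<exists>s\<in>\<rat>. s < t \<and> obj s z \<le> obj t z)
        \<longleftrightarrow> (\<exists>r. of_rat r < t \<and> obj (of_rat r) z \<le> obj t z)" for z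
      by (auto simp: Rats_def)
    moreover have "Measurable.pred ?P (\<lambda>z. s < t \<and> obj s z \<le> obj t z)" for s
    proof -
      have *: "Measurable.pred ?P (\<lambda>z. obj s z \<le> obj t z)"
        unfolding pred_def by (intro borel_measurable_le obj_meas)
      show ?thesis
      proof (cases "s < t")
        case True
        with * show ?thesis by simp
      qed simp
    qed
    ultimately show ?thesis by (simp only:) (rule pred_intros_countable)
  qed
  show "{z \<in> space ?P. cell_fit \<phi> c \<kappa> \<eta> S z q < t} \<in> sets ?P"
    unfolding eq by measurable
qed

lemma cell_fit_pen_loss_measurable:
  assumes I: "finite S" "S \<subseteq> I" "i \<in> I" and c: "c > 0"
    and \<kappa>: "\<kappa> \<in> measurable D (count_space UNIV)"
    and meas: "(\<lambda>(s, w). \<phi> s (\<eta> w)) \<in> borel_measurable (borel \<Otimes>\<^sub>M D)"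
    and convex: "\<And>w. w \<in> space D \<Longrightarrow> convex_on UNIV (\<lambda>x. \<phi> x (\<eta> w))"
    and nonneg: "\<And>w x. w \<in> space D \<Longrightarrow> \<phi> x (\<eta> w) \<ge> 0"
  shows "(\<lambda>z. pen_loss \<phi> c (cell_fit \<phi> c \<kappa> \<eta> S z (\<kappa> (z i))) (\<eta> (z i)))
           \<in> borel_measurable (Pi\<^sub>M I (\<lambda>_. D))"
proof -
  let ?P = "Pi\<^sub>M I (\<lambda>_. D)"
  have zi: "(\<lambda>z. z i) \<in> measurable ?P D" using I by (intro measurable_component_singleton) auto
  have meas1: "(\<lambda>w. \<phi> s (\<eta> w)) \<in> borel_measurable D" for s
    using measurable_compose[OF measurable_Pair1'[of s borel D] meas] by simp
  have fit[measurable]: "(\<lambda>z. cell_fit \<phi> c \<kappa> \<eta> S z (\<kappa> (z i))) \<in> borel_measurable ?P"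
  proof (rule measurable_compose_countable[where f = "\<lambda>q z. cell_fit \<phi> c \<kappa> \<eta> S z q"])
    show "(\<lambda>z. \<kappa> (z i)) \<in> measurable ?P (count_space UNIV)"
      using measurable_compose[OF zi \<kappa>] .
  qed (use I c \<kappa> meas1 convex nonneg in \<open>intro cell_fit_measurable\<close>)
  have "(\<lambda>z. \<phi> (cell_fit \<phi> c \<kappa> \<eta> S z (\<kappa> (z i))) (\<eta> (z i))) \<in> borel_measurable ?P"
    using measurable_compose[OF measurable_Pair[OF fit zi] meas] by simp
  then show ?thesis unfolding pen_loss_def by measurable
qed

text \<open>
  The fresh observation is given the index 0 and joined to the sample \<open>1, \<dots>, n\<close>. Transposing 0 and
  \<open>i\<close> preserves the product measure and turns the loss at the fresh point into the leave-one-out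
  loss at \<open>i\<close>; averaging over \<open>i\<close> makes the deterministic bound \<open>cell_fit_leave_one_out\<close> applicable.
\<close>

lemma expected_pen_loss_cell_fit:
  fixes D :: "'z measure"
  assumes D: "prob_space D" and c: "c > 0" and \<phi>bar: "\<phi>bar \<ge> 0"
    and \<kappa>: "\<kappa> \<in> measurable D (count_space UNIV)" "\<And>w. w \<in> space D \<Longrightarrow> \<kappa> w \<in> {1..k}"
    and meas: "(\<lambda>(s, w). \<phi> s (\<eta> w)) \<in> borel_measurable (borel \<Otimes>\<^sub>M D)"
    and convex: "\<And>w. w \<in> space D \<Longrightarrow> convex_on UNIV (\<lambda>x. \<phi> x (\<eta> w))"
    and nonneg: "\<And>w x. w \<in> space D \<Longrightarrow> \<phi> x (\<eta> w) \<ge> 0"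
    and bdd: "\<And>w. w \<in> space D \<Longrightarrow> \<phi> 0 (\<eta> w) \<le> \<phi>bar"
    and lip: "\<And>w a b. \<lbrakk>w \<in> space D; \<bar>a\<bar> \<le> sqrt (\<phi>bar / c); \<bar>b\<bar> \<le> sqrt (\<phi>bar / c)\<rbrakk>
                \<Longrightarrow> \<bar>\<phi> b (\<eta> w) - \<phi> a (\<eta> w)\<bar> \<le> L * \<bar>b - a\<bar>"
  shows "(\<integral>\<^sup>+z. \<integral>\<^sup>+w. ennreal (pen_loss \<phi> c (cell_fit \<phi> c \<kappa> \<eta> {1..n} z (\<kappa> w)) (\<eta> w)) \<partial>D
             \<partial>Pi\<^sub>M {1..n} (\<lambda>_. D))
    \<le> (\<integral>\<^sup>+w. ennreal (pen_loss \<phi> c (\<alpha> (\<kappa> w)) (\<eta> w)) \<partial>D)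
        + ennreal (real k * ((L + 2 * c * sqrt (\<phi>bar / c))\<^sup>2 / c) / real (Suc n))"
proof -
  interpret D: prob_space D by fact
  interpret product_sigma_finite "\<lambda>_::nat. D" by standard
  define I where "I = {0..n}"
  define \<Omega> where "\<Omega> = Pi\<^sub>M I (\<lambda>_. D)"
  define C where "C = real k * ((L + 2 * c * sqrt (\<phi>bar / c))\<^sup>2 / c)"
  define loo_loss where
    "loo_loss i z = pen_loss \<phi> c (cell_fit \<phi> c \<kappa> \<eta> (I - {i}) z (\<kappa> (z i))) (\<eta> (z i))" for i z
  have I: "finite I" "card I = Suc n" "insert 0 {1..n} = I" "I - {0} = {1..n}"
    by (auto simp: I_def)
  have C: "C \<ge> 0" using c by (simp add: C_def)
  have zD: "z i \<in> space D" if "z \<in> space \<Omega>" "i \<in> I" for z i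
    using that by (auto simp: \<Omega>_def space_PiM)
  have pen_nonneg: "pen_loss \<phi> c x (\<eta> w) \<ge> 0" if "w \<in> space D" for x w
    using nonneg[OF that, of x] c by (simp add: pen_loss_def)
  have loo_meas: "loo_loss i \<in> borel_measurable \<Omega>" if "i \<in> I" for i
    unfolding loo_loss_def[abs_def] \<Omega>_def
    by (rule cell_fit_pen_loss_measurable) (use that I c \<kappa> meas convex nonneg in auto)
  have \<alpha>_meas: "(\<lambda>w. pen_loss \<phi> c (\<alpha> (\<kappa> w)) (\<eta> w)) \<in> borel_measurable D"
  proof -
    have [measurable]: "(\<lambda>w. \<alpha> (\<kappa> w)) \<in> borel_measurable D"
      using measurable_compose[OF \<kappa>(1), of \<alpha> borel] by simp
    have "(\<lambda>w. \<phi> (\<alpha> (\<kappa> w)) (\<eta> w)) \<in> borel_measurable D"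
      using measurable_compose[OF measurable_Pair[of "\<lambda>w. \<alpha> (\<kappa> w)" D borel "\<lambda>w. w" D] meas] by simp
    then show ?thesis unfolding pen_loss_def by measurable
  qed
  have test_point: "(\<integral>\<^sup>+z. \<integral>\<^sup>+w. ennreal (pen_loss \<phi> c (cell_fit \<phi> c \<kappa> \<eta> {1..n} z (\<kappa> w)) (\<eta> w)) \<partial>D
      \<partial>Pi\<^sub>M {1..n} (\<lambda>_. D)) = (\<integral>\<^sup>+z. ennreal (loo_loss 0 z) \<partial>\<Omega>)"
  proof -
    have "(\<lambda>z. ennreal (loo_loss 0 z)) \<in> borel_measurable (Pi\<^sub>M (insert 0 {1..n}) (\<lambda>_. D))"
      using loo_meas[of 0] unfolding I(3) \<Omega>_def[symmetric] by (auto simp: I_def)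
    then have "(\<integral>\<^sup>+z. ennreal (loo_loss 0 z) \<partial>\<Omega>)
        = (\<integral>\<^sup>+z. \<integral>\<^sup>+w. ennreal (loo_loss 0 (z(0 := w))) \<partial>D \<partial>Pi\<^sub>M {1..n} (\<lambda>_. D))"
      unfolding \<Omega>_def I(3)[symmetric]
      by (intro product_nn_integral_insert) simp_all
    moreover have "loo_loss 0 (z(0 := w)) = pen_loss \<phi> c (cell_fit \<phi> c \<kappa> \<eta> {1..n} z (\<kappa> w)) (\<eta> w)" for z w
      using cell_fit_reindex[of "\<lambda>i. i" "{1..n}" "z(0 := w)" z \<phi> c \<kappa> \<eta> "\<kappa> w"]
      by (simp add: loo_loss_def I(4))
    ultimately show ?thesis by simp
  qed
  have exchange: "(\<integral>\<^sup>+z. ennreal (loo_loss i z) \<partial>\<Omega>) = (\<integral>\<^sup>+z. ennreal (loo_loss 0 z) \<partial>\<Omega>)" if i: "i \<in> I" for i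
  proof -
    define \<tau> where "\<tau> = (id(0 := i, i := 0))"
    have \<tau>: "inj \<tau>" "\<tau> 0 = i" "\<And>j. \<tau> (\<tau> j) = j" "\<And>j. j \<in> I \<Longrightarrow> \<tau> j \<in> I"
      using i by (auto simp: \<tau>_def inj_def I_def split: if_splits)
    have img: "\<tau> ` (I - {0}) = I - {i}"
    proof -
      have "\<tau> ` I \<subseteq> I" using \<tau>(4) by blast
      moreover have "j \<in> \<tau> ` I" if "j \<in> I" for j
        using \<tau>(3)[of j] \<tau>(4)[OF that] by (metis imageI)
      ultimately have "\<tau> ` I = I" by blast
      then show ?thesis using image_set_diff[OF \<tau>(1), of I "{0}"] \<tau>(2) by simp
    qed
    let ?s = "\<lambda>z. \<lambda>j\<in>I. z (\<tau> j)"
    have s_meas: "?s \<in> measurable \<Omega> \<Omega>"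
      unfolding \<Omega>_def by (intro measurable_restrict measurable_component_singleton \<tau>)
    have shift: "loo_loss 0 (?s z) = loo_loss i z" for z
    proof -
      have "cell_fit \<phi> c \<kappa> \<eta> (I - {0}) (?s z) q = cell_fit \<phi> c \<kappa> \<eta> (I - {i}) z q" for q
        unfolding img[symmetric] by (rule cell_fit_reindex) (use \<tau> in \<open>auto intro: inj_on_subset\<close>)
      moreover have "?s z 0 = z i" using \<tau> by (simp add: I_def)
      ultimately show ?thesis by (simp add: loo_loss_def)
    qed
    have "distr \<Omega> \<Omega> ?s = \<Omega>"
      unfolding \<Omega>_def by (rule distr_PiM_reindex) (use D \<tau> in \<open>auto intro: inj_on_subset\<close>)
    then have "(\<integral>\<^sup>+z. ennreal (loo_loss 0 z) \<partial>\<Omega>) = (\<integral>\<^sup>+z. ennreal (loo_loss 0 z) \<partial>distr \<Omega> \<Omega> ?s)" by simp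
    also have "\<dots> = (\<integral>\<^sup>+z. ennreal (loo_loss 0 (?s z)) \<partial>\<Omega>)"
      by (rule nn_integral_distr[OF s_meas]) (use loo_meas[of 0] in \<open>auto simp: I_def\<close>)
    finally show ?thesis by (simp only: shift)
  qed
  have marginal: "(\<integral>\<^sup>+z. ennreal (pen_loss \<phi> c (\<alpha> (\<kappa> (z i))) (\<eta> (z i))) \<partial>\<Omega>)
      = (\<integral>\<^sup>+w. ennreal (pen_loss \<phi> c (\<alpha> (\<kappa> w)) (\<eta> w)) \<partial>D)" if i: "i \<in> I" for i
  proof -
    have "(\<integral>\<^sup>+w. ennreal (pen_loss \<phi> c (\<alpha> (\<kappa> w)) (\<eta> w)) \<partial>D)
        = (\<integral>\<^sup>+w. ennreal (pen_loss \<phi> c (\<alpha> (\<kappa> w)) (\<eta> w)) \<partial>distr \<Omega> D (\<lambda>z. z i))"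
      unfolding \<Omega>_def using distr_PiM_component[of I "\<lambda>_. D" i] D i by simp
    also have "\<dots> = (\<integral>\<^sup>+z. ennreal (pen_loss \<phi> c (\<alpha> (\<kappa> (z i))) (\<eta> (z i))) \<partial>\<Omega>)"
      using i \<alpha>_meas by (intro nn_integral_distr) (auto simp: \<Omega>_def intro: measurable_component_singleton)
    finally show ?thesis ..
  qed
  have comp_meas: "(\<lambda>z. pen_loss \<phi> c (\<alpha> (\<kappa> (z i))) (\<eta> (z i))) \<in> borel_measurable \<Omega>" if "i \<in> I" for i
    unfolding \<Omega>_def
    by (rule measurable_compose[OF measurable_component_singleton[OF that] \<alpha>_meas])
  have \<Omega>_prob: "prob_space \<Omega>" unfolding \<Omega>_def by (rule prob_space_PiM) (rule D)
  define R where "R = (\<integral>\<^sup>+w. ennreal (pen_loss \<phi> c (\<alpha> (\<kappa> w)) (\<eta> w)) \<partial>D)"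
  have "of_nat (Suc n) * (\<integral>\<^sup>+z. ennreal (loo_loss 0 z) \<partial>\<Omega>) = (\<Sum>i\<in>I. \<integral>\<^sup>+z. ennreal (loo_loss i z) \<partial>\<Omega>)"
    using exchange I(2) by simp
  also have "\<dots> = (\<integral>\<^sup>+z. (\<Sum>i\<in>I. ennreal (loo_loss i z)) \<partial>\<Omega>)"
    by (rule nn_integral_sum[symmetric]) (use loo_meas in auto)
  also have "\<dots> \<le> (\<integral>\<^sup>+z. (\<Sum>i\<in>I. ennreal (pen_loss \<phi> c (\<alpha> (\<kappa> (z i))) (\<eta> (z i)))) + ennreal C \<partial>\<Omega>)"
  proof (rule nn_integral_mono)
    fix z assume z: "z \<in> space \<Omega>"
    have "(\<Sum>i\<in>I. loo_loss i z) \<le> (\<Sum>i\<in>I. pen_loss \<phi> c (\<alpha> (\<kappa> (z i))) (\<eta> (z i))) + C"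
      unfolding loo_loss_def C_def
      by (rule cell_fit_leave_one_out) (use zD[OF z] I c \<phi>bar \<kappa> convex nonneg bdd lip in auto)
    then have "ennreal (\<Sum>i\<in>I. loo_loss i z)
        \<le> ennreal ((\<Sum>i\<in>I. pen_loss \<phi> c (\<alpha> (\<kappa> (z i))) (\<eta> (z i))) + C)"
      by (rule ennreal_leI)
    also have "\<dots> = ennreal (\<Sum>i\<in>I. pen_loss \<phi> c (\<alpha> (\<kappa> (z i))) (\<eta> (z i))) + ennreal C"
      using C zD[OF z] pen_nonneg by (intro ennreal_plus sum_nonneg) auto
    finally show "(\<Sum>i\<in>I. ennreal (loo_loss i z))
        \<le> (\<Sum>i\<in>I. ennreal (pen_loss \<phi> c (\<alpha> (\<kappa> (z i))) (\<eta> (z i)))) + ennreal C"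
      using zD[OF z] pen_nonneg by (simp add: sum_ennreal loo_loss_def)
  qed
  also have "\<dots> = (\<Sum>i\<in>I. \<integral>\<^sup>+z. ennreal (pen_loss \<phi> c (\<alpha> (\<kappa> (z i))) (\<eta> (z i))) \<partial>\<Omega>) + ennreal C"
    using comp_meas prob_space.emeasure_space_1[OF \<Omega>_prob]
    by (subst nn_integral_add) (auto simp: nn_integral_sum)
  also have "\<dots> = of_nat (Suc n) * R + ennreal C"
    using marginal I(2) by (simp add: R_def)
  also have "\<dots> = of_nat (Suc n) * (R + ennreal (C / real (Suc n)))"
  proof -
    have "ennreal C = ennreal (real (Suc n) * (C / real (Suc n)))" by simp
    also have "\<dots> = of_nat (Suc n) * ennreal (C / real (Suc n))"
      using C by (subst ennreal_mult) (auto simp: ennreal_of_nat_eq_real_of_nat simp del: of_nat_Suc)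
    finally show ?thesis by (simp only: distrib_left)
  qed
  finally have "(\<integral>\<^sup>+z. ennreal (loo_loss 0 z) \<partial>\<Omega>) \<le> R + ennreal (C / real (Suc n))"
    by (subst (asm) ennreal_mult_le_mult_iff) auto
  then show ?thesis unfolding test_point R_def C_def .
qed

section \<open>From the product space to an i.i.d. sample\<close>

lemma cell_fit_test_loss_measurable:
  fixes D :: "'z measure" and n :: nat
  assumes D: "prob_space D" and c: "c > 0"
    and \<kappa>: "\<kappa> \<in> measurable D (count_space UNIV)"
    and meas: "(\<lambda>(s, w). \<phi> s (\<eta> w)) \<in> borel_measurable (borel \<Otimes>\<^sub>M D)"
    and convex: "\<And>w. w \<in> space D \<Longrightarrow> convex_on UNIV (\<lambda>x. \<phi> x (\<eta> w))"
    and nonneg: "\<And>w x. w \<in> space D \<Longrightarrow> \<phi> x (\<eta> w) \<ge> 0"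
  shows "(\<lambda>z. \<integral>\<^sup>+w. ennreal (pen_loss \<phi> c (cell_fit \<phi> c \<kappa> \<eta> {1..n} z (\<kappa> w)) (\<eta> w)) \<partial>D)
           \<in> borel_measurable (Pi\<^sub>M {1..n} (\<lambda>_. D))"
proof -
  interpret D: prob_space D by fact
  let ?l = "\<lambda>z::nat \<Rightarrow> 'z. pen_loss \<phi> c (cell_fit \<phi> c \<kappa> \<eta> {1..n} z (\<kappa> (z 0))) (\<eta> (z 0))"
  have l: "?l \<in> borel_measurable (Pi\<^sub>M (insert 0 {1..n}) (\<lambda>_. D))"
    by (rule cell_fit_pen_loss_measurable) (use assms in auto)
  have "(\<lambda>x. ?l (case x of (z, w) \<Rightarrow> z(0 := w))) \<in> borel_measurable (Pi\<^sub>M {1..n} (\<lambda>_. D) \<Otimes>\<^sub>M D)"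
    by (rule measurable_compose[OF measurable_add_dim l])
  moreover have "?l (z(0 := w)) = pen_loss \<phi> c (cell_fit \<phi> c \<kappa> \<eta> {1..n} z (\<kappa> w)) (\<eta> w)" for z w
    using cell_fit_reindex[of "\<lambda>i. i" "{1..n}" "z(0 := w)" z \<phi> c \<kappa> \<eta> "\<kappa> w"] by simp
  then have "(\<lambda>x. ?l (case x of (z, w) \<Rightarrow> z(0 := w)))
      = (\<lambda>(z, w). pen_loss \<phi> c (cell_fit \<phi> c \<kappa> \<eta> {1..n} z (\<kappa> w)) (\<eta> w))"
    by (simp only: fun_eq_iff split_paired_All prod.case) blast
  ultimately have "(\<lambda>(z, w). pen_loss \<phi> c (cell_fit \<phi> c \<kappa> \<eta> {1..n} z (\<kappa> w)) (\<eta> w))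
      \<in> borel_measurable (Pi\<^sub>M {1..n} (\<lambda>_. D) \<Otimes>\<^sub>M D)"
    by (simp only:)
  from measurable_compose[OF this measurable_ennreal]
  have "(\<lambda>(z, w). ennreal (pen_loss \<phi> c (cell_fit \<phi> c \<kappa> \<eta> {1..n} z (\<kappa> w)) (\<eta> w)))
      \<in> borel_measurable (Pi\<^sub>M {1..n} (\<lambda>_. D) \<Otimes>\<^sub>M D)"
    by (simp only: case_prod_beta')
  then show ?thesis by (rule D.borel_measurable_nn_integral)
qed

text \<open>
  Variables with values in \<open>\<Omega>\<close> generate the same events from \<open>K\<close> and from its trace on \<open>\<Omega>\<close>. Since
  \<open>\<Omega>\<close> may be non-measurable, the trace is the space on which a loss defined only on \<open>\<Omega>\<close> is
  measurable.
\<close>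

lemma (in prob_space) indep_vars_restrict_space:
  assumes "indep_vars (\<lambda>_. K) Z J" and val: "\<And>i \<omega>. i \<in> J \<Longrightarrow> \<omega> \<in> space M \<Longrightarrow> Z i \<omega> \<in> \<Omega>"
  shows "indep_vars (\<lambda>_. restrict_space K \<Omega>) Z J"
proof -
  have rv: "random_variable K (Z i)" if "i \<in> J" for i
    using assms(1) that by (simp add: indep_vars_def2)
  have "{Z i -` A \<inter> space M |A. A \<in> sets (restrict_space K \<Omega>)} = {Z i -` A \<inter> space M |A. A \<in> sets K}"
    if i: "i \<in> J" for i
  proof -
    have "Z i -` (\<Omega> \<inter> A) \<inter> space M = Z i -` A \<inter> space M" for A
      using val[OF i] by auto
    then have "(\<lambda>A. Z i -` A \<inter> space M) ` (\<lambda>A. \<Omega> \<inter> A) ` sets K = (\<lambda>A. Z i -` A \<inter> space M) ` sets K"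
      by (simp only: image_image)
    then show ?thesis by (simp only: sets_restrict_space Setcompr_eq_image)
  qed
  then have "indep_sets (\<lambda>i. {Z i -` A \<inter> space M |A. A \<in> sets (restrict_space K \<Omega>)}) J
      \<longleftrightarrow> indep_sets (\<lambda>i. {Z i -` A \<inter> space M |A. A \<in> sets K}) J"
    by (rule indep_sets_cong[OF refl])
  moreover have "random_variable (restrict_space K \<Omega>) (Z i)" if "i \<in> J" for i
    using rv[OF that] val[OF that] by (intro measurable_restrict_space2) auto
  ultimately show ?thesis using assms(1) unfolding indep_vars_def2 by blast
qed

lemma distr_restrict_space_cong:
  assumes Z: "Z \<in> measurable M K" "Z' \<in> measurable M K"
    and val: "\<And>\<omega>. \<omega> \<in> space M \<Longrightarrow> Z \<omega> \<in> \<Omega>" "\<And>\<omega>. \<omega> \<in> space M \<Longrightarrow> Z' \<omega> \<in> \<Omega>"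
    and eq: "distr M K Z = distr M K Z'"
  shows "distr M (restrict_space K \<Omega>) Z = distr M (restrict_space K \<Omega>) Z'"
proof (rule measure_eqI)
  fix A assume "A \<in> sets (distr M (restrict_space K \<Omega>) Z)"
  then obtain B where B: "B \<in> sets K" "A = \<Omega> \<inter> B" by (auto simp: sets_restrict_space)
  have A: "A \<in> sets (restrict_space K \<Omega>)" using B by (auto simp: sets_restrict_space)
  have "emeasure (distr M (restrict_space K \<Omega>) Y) A = emeasure (distr M K Y) B"
    if "Y \<in> measurable M K" "\<And>\<omega>. \<omega> \<in> space M \<Longrightarrow> Y \<omega> \<in> \<Omega>" for Y
  proof -
    have "Y -` A \<inter> space M = Y -` B \<inter> space M" using that B by auto
    then show ?thesis
      using A B that by (simp add: emeasure_distr measurable_restrict_space2)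
  qed
  with Z val eq show "emeasure (distr M (restrict_space K \<Omega>) Z) A = emeasure (distr M (restrict_space K \<Omega>) Z') A"
    by simp
qed simp

lemma expected_pen_loss_iid:
  fixes Z :: "nat \<Rightarrow> 'a \<Rightarrow> 'z" and E :: "'z measure"
  assumes M: "prob_space M" and n: "n \<ge> 1" and c: "c > 0" and \<phi>bar: "\<phi>bar \<ge> 0"
    and indep: "prob_space.indep_vars M (\<lambda>_. E) Z {1..}"
    and ident: "\<And>i. i \<ge> 1 \<Longrightarrow> distr M E (Z i) = D"
    and \<kappa>: "\<kappa> \<in> measurable E (count_space UNIV)" "\<And>w. w \<in> space E \<Longrightarrow> \<kappa> w \<in> {1..k}"
    and meas: "(\<lambda>(s, w). \<phi> s (\<eta> w)) \<in> borel_measurable (borel \<Otimes>\<^sub>M E)"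
    and convex: "\<And>w. w \<in> space E \<Longrightarrow> convex_on UNIV (\<lambda>x. \<phi> x (\<eta> w))"
    and nonneg: "\<And>w x. w \<in> space E \<Longrightarrow> \<phi> x (\<eta> w) \<ge> 0"
    and bdd: "\<And>w. w \<in> space E \<Longrightarrow> \<phi> 0 (\<eta> w) \<le> \<phi>bar"
    and lip: "\<And>w a b. \<lbrakk>w \<in> space E; \<bar>a\<bar> \<le> sqrt (\<phi>bar / c); \<bar>b\<bar> \<le> sqrt (\<phi>bar / c)\<rbrakk>
                \<Longrightarrow> \<bar>\<phi> b (\<eta> w) - \<phi> a (\<eta> w)\<bar> \<le> L * \<bar>b - a\<bar>"
  shows "(\<integral>\<^sup>+\<omega>. \<integral>\<^sup>+w. ennreal (pen_loss \<phi> c (cell_fit \<phi> c \<kappa> \<eta> {1..n} (\<lambda>i. Z i \<omega>) (\<kappa> w)) (\<eta> w)) \<partial>D \<partial>M)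
    \<le> (\<integral>\<^sup>+w. ennreal (pen_loss \<phi> c (\<alpha> (\<kappa> w)) (\<eta> w)) \<partial>D)
        + ennreal (real k * ((L + 2 * c * sqrt (\<phi>bar / c))\<^sup>2 / c) / real (Suc n))"
proof -
  interpret prob_space M by fact
  have Z: "Z i \<in> measurable M E" if "i \<ge> 1" for i
    using indep that by (simp add: indep_vars_def2)
  have D: "prob_space D" using prob_space_distr[OF Z[of 1]] ident[of 1] by simp
  have sD: "sets D = sets E" "space D = space E" using ident[of 1] by auto
  have PE: "sets (Pi\<^sub>M {1..n} (\<lambda>_. E)) = sets (Pi\<^sub>M {1..n} (\<lambda>_. D))"
    by (intro sets_PiM_cong) (auto simp: sD)
  have \<kappa>D: "\<kappa> \<in> measurable D (count_space UNIV)"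
    using \<kappa>(1) measurable_cong_sets[OF sD(1) refl] by blast
  have measD: "(\<lambda>(s, w). \<phi> s (\<eta> w)) \<in> borel_measurable (borel \<Otimes>\<^sub>M D)"
    using meas measurable_cong_sets[OF sets_pair_measure_cong[OF refl sD(1)] refl] by blast
  define r where
    "r z = (\<integral>\<^sup>+w. ennreal (pen_loss \<phi> c (cell_fit \<phi> c \<kappa> \<eta> {1..n} z (\<kappa> w)) (\<eta> w)) \<partial>D)" for z
  have r_meas: "r \<in> borel_measurable (Pi\<^sub>M {1..n} (\<lambda>_. E))"
    unfolding r_def[abs_def] measurable_cong_sets[OF PE refl]
    by (rule cell_fit_test_loss_measurable) (use D c \<kappa>D measD convex nonneg sD in auto)
  have joint: "distr M (Pi\<^sub>M {1..n} (\<lambda>_. E)) (\<lambda>\<omega>. \<lambda>i\<in>{1..n}. Z i \<omega>) = Pi\<^sub>M {1..n} (\<lambda>_. D)"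
  proof -
    have "indep_vars (\<lambda>_. E) Z {1..n}" by (rule indep_vars_subset[OF indep]) auto
    then have "distr M (Pi\<^sub>M {1..n} (\<lambda>_. E)) (\<lambda>\<omega>. \<lambda>i\<in>{1..n}. Z i \<omega>)
        = Pi\<^sub>M {1..n} (\<lambda>i. distr M E (Z i))"
      by (subst (asm) indep_vars_iff_distr_eq_PiM') (use n Z in auto)
    also have "\<dots> = Pi\<^sub>M {1..n} (\<lambda>_. D)" by (intro PiM_cong) (auto simp: ident)
    finally show ?thesis .
  qed
  have "(\<integral>\<^sup>+\<omega>. r (\<lambda>i. Z i \<omega>) \<partial>M) = (\<integral>\<^sup>+\<omega>. r (\<lambda>i\<in>{1..n}. Z i \<omega>) \<partial>M)"
  proof -
    have "cell_fit \<phi> c \<kappa> \<eta> {1..n} (\<lambda>i. Z i \<omega>) q = cell_fit \<phi> c \<kappa> \<eta> {1..n} (\<lambda>i\<in>{1..n}. Z i \<omega>) q" for \<omega> q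
      using cell_fit_reindex[of "\<lambda>i. i" "{1..n}" "\<lambda>i. Z i \<omega>" "\<lambda>i\<in>{1..n}. Z i \<omega>"] by simp
    then show ?thesis by (simp add: r_def)
  qed
  also have "\<dots> = (\<integral>\<^sup>+z. r z \<partial>distr M (Pi\<^sub>M {1..n} (\<lambda>_. E)) (\<lambda>\<omega>. \<lambda>i\<in>{1..n}. Z i \<omega>))"
    by (rule nn_integral_distr[symmetric, OF measurable_restrict]) (use Z r_meas in auto)
  also have "\<dots> = (\<integral>\<^sup>+z. r z \<partial>Pi\<^sub>M {1..n} (\<lambda>_. D))" by (simp only: joint)
  also have "\<dots> \<le> (\<integral>\<^sup>+w. ennreal (pen_loss \<phi> c (\<alpha> (\<kappa> w)) (\<eta> w)) \<partial>D)
        + ennreal (real k * ((L + 2 * c * sqrt (\<phi>bar / c))\<^sup>2 / c) / real (Suc n))"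
    unfolding r_def
    by (rule expected_pen_loss_cell_fit) (use D c \<phi>bar \<kappa>D measD \<kappa> convex nonneg bdd lip sD in auto)
  finally show ?thesis by (simp add: r_def)
qed

section \<open>The predictor in terms of cells\<close>

text \<open>
  For disjoint cells there is at most one admissible \<open>j\<close>; the least one is taken because this
  choice is measurable without further argument.
\<close>

definition cell_index :: "nat \<Rightarrow> (nat \<Rightarrow> 'b set) \<Rightarrow> 'b \<Rightarrow> nat" where
  "cell_index k C x = (LEAST j. j \<in> {1..k} \<and> x \<in> C j)"

lemma cell_index_eq:
  assumes "disjoint_family_on C {1..k}" "j \<in> {1..k}" "x \<in> C j"
  shows "cell_index k C x = j"
proof -
  have "i = j" if "i \<in> {1..k} \<and> x \<in> C i" for i
    using assms that unfolding disjoint_family_on_def by blast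
  moreover have "cell_index k C x \<in> {1..k} \<and> x \<in> C (cell_index k C x)"
    unfolding cell_index_def by (rule LeastI[of _ j]) (use assms in blast)
  ultimately show ?thesis by blast
qed

lemma cell_index_in:
  assumes "x \<in> (\<Union>j\<in>{1..k}. C j)"
  shows "cell_index k C x \<in> {1..k}" "x \<in> C (cell_index k C x)"
proof -
  have "\<exists>j. j \<in> {1..k} \<and> x \<in> C j" using assms by blast
  from LeastI_ex[OF this] show "cell_index k C x \<in> {1..k}" "x \<in> C (cell_index k C x)"
    unfolding cell_index_def by blast+
qed

lemma cell_eq:
  assumes "disjoint_family_on C {1..k}" "j \<in> {1..k}" "x \<in> C j"
  shows "cell k C x = C j"
proof -
  have "i = j" if "i \<in> {1..k}" "x \<in> C i" for i
    using assms that unfolding disjoint_family_on_def by blast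
  then have "{C i |i. i \<in> {1..k} \<and> x \<in> C i} = {C j}" using assms(2,3) by blast
  then show ?thesis by (simp only: cell_def Union_insert Union_empty Un_empty_right)
qed

lemma cell_index_measurable:
  assumes "\<And>j. j \<in> {1..k} \<Longrightarrow> C j \<in> sets M"
  shows "cell_index k C \<in> measurable M (count_space UNIV)"
proof -
  have "Measurable.pred M (\<lambda>x. j \<in> {1..k} \<and> x \<in> C j)" for j
  proof -
    have "{x \<in> space M. j \<in> {1..k} \<and> x \<in> C j} \<in> sets M"
    proof (cases "j \<in> {1..k}")
      case True
      then have "{x \<in> space M. j \<in> {1..k} \<and> x \<in> C j} = C j \<inter> space M" by blast
      then show ?thesis using sets.Int[OF assms[OF True] sets.top] by (simp only:)
    next
      case False
      then have "{x \<in> space M. j \<in> {1..k} \<and> x \<in> C j} = {}" by blast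
      then show ?thesis by (simp only: sets.empty_sets)
    qed
    then show ?thesis by (simp only: pred_def)
  qed
  then show ?thesis
    unfolding cell_index_def[abs_def]
    by (rule measurable_Least[where P = "\<lambda>j x. j \<in> {1..k} \<and> x \<in> C j"])
qed

lemma step_sum_eq:
  fixes \<alpha> :: "nat \<Rightarrow> real"
  assumes "disjoint_family_on C {1..k}" "j \<in> {1..k}" "x \<in> C j"
  shows "(\<Sum>i=1..k. \<alpha> i * indicator (C i) x) = \<alpha> j"
proof -
  have "x \<notin> C i" if "i \<in> {1..k}" "i \<noteq> j" for i
    using assms that unfolding disjoint_family_on_def by blast
  then have "(\<Sum>i=1..k. \<alpha> i * indicator (C i) x) = (\<Sum>i=1..k. if i = j then \<alpha> i else 0)"
    using assms by (intro sum.cong) (auto simp: indicator_def)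
  then show ?thesis using assms by simp
qed

lemma pen_emp_risk_eq:
  "pen_emp_risk \<phi> \<gamma> X Y n \<omega> F = (1 / real n) * (\<Sum>i=1..n. pen_loss \<phi> (\<gamma> n) (F (X i \<omega>)) (Y i \<omega>))"
  by (simp add: pen_emp_risk_def emp_risk_def emp_norm_sq_def pen_loss_def sum.distrib
      sum_distrib_left algebra_simps)

text \<open>
  Changing the value of a step function on one cell affects only the terms of the observations in
  this cell, so a minimizer over all step functions minimizes every cell separately. On cells with
  observations the minimizer is unique; on the others both sides are 0.
\<close>

lemma predictor_eq_cell_fit:
  assumes pred: "is_predictor \<phi> \<gamma> X Y S k C n \<omega> F"
    and form: "lin S = step_functions k C" and disj: "disjoint_family_on C {1..k}"
    and cover: "\<And>i. i \<in> {1..n} \<Longrightarrow> X i \<omega> \<in> (\<Union>j\<in>{1..k}. C j)"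
    and convex: "\<And>i. i \<in> {1..n} \<Longrightarrow> convex_on UNIV (\<lambda>x. \<phi> x (Y i \<omega>))"
    and \<gamma>: "\<gamma> n > 0" and j: "j \<in> {1..k}" "x \<in> C j"
  shows "F x = cell_fit \<phi> (\<gamma> n) (\<lambda>w. cell_index k C (fst w)) snd {1..n} (\<lambda>i. (X i \<omega>, Y i \<omega>)) j"
proof -
  define T where "T = {i \<in> {1..n}. cell_index k C (X i \<omega>) = j}"
  have inC: "cell_index k C (X i \<omega>) \<in> {1..k}" "X i \<omega> \<in> C (cell_index k C (X i \<omega>))"
    if "i \<in> {1..n}" for i
    using cell_index_in[OF cover[OF that]] by auto
  have fit: "cell_fit \<phi> (\<gamma> n) (\<lambda>w. cell_index k C (fst w)) snd {1..n} (\<lambda>i. (X i \<omega>, Y i \<omega>)) j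
      = ridge_fit \<phi> (\<gamma> n) T (\<lambda>i. Y i \<omega>)"
    by (simp add: cell_fit_def T_def)
  show ?thesis
  proof (cases "T = {}")
    case True
    then have "\<forall>i\<in>{1..n}. X i \<omega> \<notin> C j"
      using cell_index_eq[OF disj j(1)] by (auto simp: T_def)
    then have "F x = 0" using pred j by (auto simp: is_predictor_def)
    then show ?thesis unfolding fit by (simp add: True ridge_fit_def)
  next
    case False
    then have n: "n \<ge> 1" by (auto simp: T_def)
    have "F \<in> lin S" using pred by (simp add: is_predictor_def is_arg_min_def)
    then obtain \<alpha> where F: "F = (\<lambda>x. \<Sum>j=1..k. \<alpha> j * indicator (C j) x)"
      unfolding form step_functions_def by blast
    have Fx: "F x = \<alpha> j" unfolding F by (rule step_sum_eq[OF disj j])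
    have "pen_sum \<phi> (\<gamma> n) T (\<lambda>i. Y i \<omega>) (\<alpha> j) \<le> pen_sum \<phi> (\<gamma> n) T (\<lambda>i. Y i \<omega>) b" for b
    proof -
      define G where "G = (\<lambda>x. \<Sum>i=1..k. (\<alpha>(j := b)) i * indicator (C i) x)"
      have "G \<in> lin S" unfolding form step_functions_def G_def by blast
      then have "pen_emp_risk \<phi> \<gamma> X Y n \<omega> F \<le> pen_emp_risk \<phi> \<gamma> X Y n \<omega> G"
        using pred by (auto simp: is_predictor_def is_arg_min_def not_less)
      then have le: "(\<Sum>i=1..n. pen_loss \<phi> (\<gamma> n) (F (X i \<omega>)) (Y i \<omega>))
          \<le> (\<Sum>i=1..n. pen_loss \<phi> (\<gamma> n) (G (X i \<omega>)) (Y i \<omega>))"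
        using n by (simp add: pen_emp_risk_eq divide_le_cancel)
      have split: "(\<Sum>i=1..n. h i) = (\<Sum>i\<in>T. h i) + (\<Sum>i\<in>{1..n} - T. h i)" for h :: "nat \<Rightarrow> real"
        by (subst sum.subset_diff[of T]) (auto simp: T_def)
      have val: "(\<Sum>l=1..k. \<beta> l * indicator (C l) (X i \<omega>)) = \<beta> (cell_index k C (X i \<omega>))"
        if "i \<in> {1..n}" for i and \<beta> :: "nat \<Rightarrow> real"
        by (rule step_sum_eq[OF disj inC[OF that]])
      have Fv: "F (X i \<omega>) = \<alpha> (cell_index k C (X i \<omega>))"
        and Gv: "G (X i \<omega>) = (\<alpha>(j := b)) (cell_index k C (X i \<omega>))" if "i \<in> {1..n}" for i
        unfolding F G_def by (rule val[OF that])+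
      have "(\<Sum>i\<in>{1..n} - T. pen_loss \<phi> (\<gamma> n) (F (X i \<omega>)) (Y i \<omega>))
          = (\<Sum>i\<in>{1..n} - T. pen_loss \<phi> (\<gamma> n) (G (X i \<omega>)) (Y i \<omega>))"
      proof (rule sum.cong[OF refl])
        fix i assume "i \<in> {1..n} - T"
        then have i: "i \<in> {1..n}" "cell_index k C (X i \<omega>) \<noteq> j" by (simp_all add: T_def)
        then show "pen_loss \<phi> (\<gamma> n) (F (X i \<omega>)) (Y i \<omega>) = pen_loss \<phi> (\<gamma> n) (G (X i \<omega>)) (Y i \<omega>)"
          by (simp add: Fv[OF i(1)] Gv[OF i(1)])
      qed
      moreover have "(\<Sum>i\<in>T. pen_loss \<phi> (\<gamma> n) (F (X i \<omega>)) (Y i \<omega>)) = pen_sum \<phi> (\<gamma> n) T (\<lambda>i. Y i \<omega>) (\<alpha> j)"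
        unfolding pen_sum_def by (rule sum.cong[OF refl]) (simp add: Fv T_def)
      moreover have "(\<Sum>i\<in>T. pen_loss \<phi> (\<gamma> n) (G (X i \<omega>)) (Y i \<omega>)) = pen_sum \<phi> (\<gamma> n) T (\<lambda>i. Y i \<omega>) b"
        unfolding pen_sum_def by (rule sum.cong[OF refl]) (simp add: Gv T_def)
      ultimately show ?thesis using le unfolding split by simp
    qed
    then have "ridge_fit \<phi> (\<gamma> n) T (\<lambda>i. Y i \<omega>) = \<alpha> j"
      by (intro ridge_fit_eqI) (use False \<gamma> convex in \<open>auto simp: T_def\<close>)
    then show ?thesis unfolding fit by (simp add: Fx)
  qed
qed

section \<open>Approximation of the optimal function\<close>

text \<open>
  A Lebesgue measurable function is an almost everywhere limit of continuous functions. Truncating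
  these at the bound of \<open>f\<close> does not disturb the limit and makes dominated convergence applicable.
\<close>

lemma continuous_L1_approximation:
  fixes f :: "'b::euclidean_space \<Rightarrow> real"
  assumes P: "prob_space P" "sets P = sets borel" and ac: "absolutely_continuous lborel P"
    and f: "f \<in> borel_measurable borel" and B: "AE x in P. \<bar>f x\<bar> \<le> B" and \<epsilon>: "\<epsilon> > 0"
  shows "\<exists>h. continuous_on UNIV h \<and> (\<forall>x. \<bar>h x\<bar> \<le> \<bar>B\<bar>) \<and> (\<integral>x. \<bar>h x - f x\<bar> \<partial>P) < \<epsilon>"
proof -
  interpret prob_space P by fact
  have "f measurable_on UNIV"
    by (rule lebesgue_measurable_imp_measurable_on_real) (use f in \<open>auto intro: measurable_completion\<close>)
  then obtain N g where N: "negligible N" and g: "\<And>n. continuous_on UNIV (g n)"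
    and lim: "\<And>x. x \<notin> N \<Longrightarrow> (\<lambda>n. g n x) \<longlonglongrightarrow> f x"
    by (auto simp: measurable_on_def)
  define h where "h n x = max (- \<bar>B\<bar>) (min \<bar>B\<bar> (g n x))" for n x
  have h: "continuous_on UNIV (h n)" "\<bar>h n x\<bar> \<le> \<bar>B\<bar>" for n x
    unfolding h_def by (auto intro!: continuous_intros g)
  have "N \<in> null_sets lebesgue" using N by (simp add: negligible_iff_null_sets)
  then obtain N' where N': "N' \<in> null_sets lborel" "N \<subseteq> N'"
    unfolding null_sets_completion_iff2 by blast
  then have "N' \<in> null_sets P" using ac by (auto simp: absolutely_continuous_def)
  then have "AE x in P. x \<notin> N" using AE_not_in[of N' P] N'(2) by (auto elim!: AE_mp)
  with B have conv: "AE x in P. (\<lambda>n. \<bar>h n x - f x\<bar>) \<longlonglongrightarrow> 0"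
  proof (eventually_elim)
    case (elim x)
    have "(\<lambda>n. \<bar>h n x - f x\<bar>) \<longlonglongrightarrow> \<bar>max (- \<bar>B\<bar>) (min \<bar>B\<bar> (f x)) - f x\<bar>"
      unfolding h_def using elim by (intro tendsto_intros lim) auto
    moreover have "max (- \<bar>B\<bar>) (min \<bar>B\<bar> (f x)) = f x" using elim by auto
    ultimately show ?case by simp
  qed
  have hm: "h n \<in> borel_measurable P" for n
    using borel_measurable_continuous_onI[OF h(1)] measurable_cong_sets[OF P(2) refl] by blast
  have fm: "f \<in> borel_measurable P" using f measurable_cong_sets[OF P(2) refl] by blast
  have "(\<lambda>n. \<integral>x. \<bar>h n x - f x\<bar> \<partial>P) \<longlonglongrightarrow> (\<integral>x. 0 \<partial>P)"
  proof (rule integral_dominated_convergence[where w = "\<lambda>_. 2 * \<bar>B\<bar>"])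
    show "AE x in P. norm \<bar>h n x - f x\<bar> \<le> 2 * \<bar>B\<bar>" for n
      using B
    proof eventually_elim
      case (elim x)
      then show ?case using h(2)[of n x] by simp
    qed
  qed (use conv hm fm in auto)
  then have "eventually (\<lambda>n. (\<integral>x. \<bar>h n x - f x\<bar> \<partial>P) < \<epsilon>) sequentially"
    using \<epsilon> by (intro order_tendstoD) auto
  then obtain n where "(\<integral>x. \<bar>h n x - f x\<bar> \<partial>P) < \<epsilon>" by (auto simp: eventually_sequentially)
  then show ?thesis using h by blast
qed

text \<open>
  First \<open>f\<close> is replaced by a continuous function \<open>h\<close>, then \<open>h\<close> by its value at an arbitrary point of
  each cell. On cells of small diameter the second error is small by uniform continuity; the other
  cells carry little mass, and there the error is at most twice the bound.
\<close>

lemma step_L1_approximation: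
  fixes f :: "'b::euclidean_space \<Rightarrow> real" and A :: "nat \<Rightarrow> nat \<Rightarrow> 'b set"
  assumes P: "prob_space P" "sets P = sets borel" and ac: "absolutely_continuous lborel P"
    and \<X>: "compact \<X>" "AE x in P. x \<in> \<X>"
    and f: "f \<in> borel_measurable borel" and B: "AE x in P. \<bar>f x\<bar> \<le> B" and \<epsilon>: "\<epsilon> > 0"
    and cells: "\<And>n j. n \<ge> 1 \<Longrightarrow> j \<in> {1..N n} \<Longrightarrow> A n j \<in> sets borel"
    and disj: "\<And>n. n \<ge> 1 \<Longrightarrow> disjoint_family_on (A n) {1..N n}"
    and cover: "\<And>n. n \<ge> 1 \<Longrightarrow> (\<Union>j\<in>{1..N n}. A n j) = \<X>"
    and diam: "\<And>\<delta>. \<delta> > 0 \<Longrightarrow>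
      (\<lambda>n. measure P {x \<in> space P. diameter (cell (N n) (A n) x) > \<delta>}) \<longlonglongrightarrow> 0"
  shows "eventually (\<lambda>n. \<exists>\<alpha>. (\<forall>j. \<bar>\<alpha> j\<bar> \<le> \<bar>B\<bar>) \<and>
    (\<integral>x. \<bar>\<alpha> (cell_index (N n) (A n) x) - f x\<bar> \<partial>P) < \<epsilon>) sequentially"
proof -
  interpret prob_space P by fact
  have spP: "space P = UNIV" using sets_eq_imp_space_eq[OF P(2)] by simp
  obtain h where h: "continuous_on UNIV h" "\<And>x. \<bar>h x\<bar> \<le> \<bar>B\<bar>" and hf: "(\<integral>x. \<bar>h x - f x\<bar> \<partial>P) < \<epsilon> / 2"
    using continuous_L1_approximation[OF P ac f B, of "\<epsilon> / 2"] \<epsilon> by auto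
  have "uniformly_continuous_on \<X> h"
    using h(1) \<X>(1) by (intro compact_uniformly_continuous) (auto intro: continuous_on_subset)
  then obtain \<delta> where \<delta>: "\<delta> > 0"
    and uc: "\<And>x x'. x \<in> \<X> \<Longrightarrow> x' \<in> \<X> \<Longrightarrow> dist x' x < \<delta> \<Longrightarrow> dist (h x') (h x) < \<epsilon> / 4"
    using \<epsilon> unfolding uniformly_continuous_on_def by (metis divide_pos_pos zero_less_numeral)
  define E where "E n = {x \<in> space P. diameter (cell (N n) (A n) x) > \<delta> / 2}" for n
  have "(\<lambda>n. \<epsilon> / 4 + 2 * \<bar>B\<bar> * measure P (E n)) \<longlonglongrightarrow> \<epsilon> / 4 + 2 * \<bar>B\<bar> * 0"
    unfolding E_def using \<delta> by (intro tendsto_intros diam) auto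
  then have "eventually (\<lambda>n. \<epsilon> / 4 + 2 * \<bar>B\<bar> * measure P (E n) < \<epsilon> / 2) sequentially"
    using \<epsilon> by (intro order_tendstoD) auto
  then show ?thesis using eventually_ge_at_top[of 1]
  proof eventually_elim
    case (elim n)
    define \<kappa> where "\<kappa> = cell_index (N n) (A n)"
    have \<kappa>_in: "\<kappa> x \<in> {1..N n}" "x \<in> A n (\<kappa> x)" if "x \<in> \<X>" for x
      unfolding \<kappa>_def using that cell_index_in[of x "A n" "N n"] cover[OF elim(2)] by auto
    define \<alpha> where "\<alpha> j = h (SOME x. x \<in> A n j)" for j
    have \<kappa>_meas: "\<kappa> \<in> measurable P (count_space UNIV)"
      unfolding \<kappa>_def using cells[OF elim(2)] P(2) by (intro cell_index_measurable) auto
    have [measurable]: "(\<lambda>x. \<alpha> (\<kappa> x)) \<in> borel_measurable P"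
      by (rule measurable_compose[OF \<kappa>_meas]) simp
    have [measurable]: "h \<in> borel_measurable P"
      using borel_measurable_continuous_onI[OF h(1)] measurable_cong_sets[OF P(2) refl] by blast
    have [measurable]: "f \<in> borel_measurable P"
      using f measurable_cong_sets[OF P(2) refl] by blast
    \<comment> \<open>Measurability matters: the measure of a non-measurable set is 0 by convention, and then the
        hypothesis on the diameters would carry no information.\<close>
    have E_meas[measurable]: "E n \<in> sets P"
    proof -
      have "E n = (\<Union>j\<in>{j\<in>{1..N n}. diameter (A n j) > \<delta> / 2}. A n j)"
      proof (intro set_eqI iffI)
        fix x assume x: "x \<in> E n"
        have "x \<in> \<X>"
        proof (rule ccontr)
          assume "x \<notin> \<X>"
          then have "cell (N n) (A n) x = {}"
            using cover[OF elim(2)] unfolding cell_def by blast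
          then show False using x \<delta> by (simp add: E_def)
        qed
        note \<kappa>x = \<kappa>_in[OF \<open>x \<in> \<X>\<close>]
        have "diameter (A n (\<kappa> x)) > \<delta> / 2"
          using x cell_eq[OF disj[OF elim(2)] \<kappa>x] by (simp add: E_def)
        with \<kappa>x show "x \<in> (\<Union>j\<in>{j\<in>{1..N n}. diameter (A n j) > \<delta> / 2}. A n j)"
          by blast
      next
        fix x assume "x \<in> (\<Union>j\<in>{j\<in>{1..N n}. diameter (A n j) > \<delta> / 2}. A n j)"
        then show "x \<in> E n" using cell_eq[OF disj[OF elim(2)]] by (auto simp: E_def spP)
      qed
      also have "\<dots> \<in> sets P" using cells[OF elim(2)] P(2) by (intro sets.finite_UN) auto
      finally show ?thesis .
    qed
    have ptw: "\<bar>\<alpha> (\<kappa> x) - h x\<bar> \<le> \<epsilon> / 4 + 2 * \<bar>B\<bar> * indicator (E n) x" if x: "x \<in> \<X>" for x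
    proof (cases "x \<in> E n")
      case True
      have "\<bar>\<alpha> (\<kappa> x) - h x\<bar> \<le> \<bar>\<alpha> (\<kappa> x)\<bar> + \<bar>h x\<bar>" by (rule abs_triangle_ineq4)
      also have "\<dots> \<le> 2 * \<bar>B\<bar>" using h(2)[of x] h(2)[of "SOME y. y \<in> A n (\<kappa> x)"] unfolding \<alpha>_def by linarith
      finally show ?thesis using True \<epsilon> by simp
    next
      case False
      let ?y = "SOME y. y \<in> A n (\<kappa> x)"
      have y: "?y \<in> A n (\<kappa> x)" by (rule someI) (rule \<kappa>_in[OF x])
      have sub: "A n (\<kappa> x) \<subseteq> \<X>" using cover[OF elim(2)] \<kappa>_in[OF x] by blast
      have "dist ?y x \<le> diameter (A n (\<kappa> x))"
        using sub \<X>(1) y \<kappa>_in[OF x]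
        by (intro diameter_bounded_bound) (auto intro: bounded_subset compact_imp_bounded)
      also have "\<dots> \<le> \<delta> / 2"
        using False cell_eq[OF disj[OF elim(2)] \<kappa>_in[OF x]] by (simp add: E_def spP)
      finally have "dist ?y x < \<delta>" using \<delta> by simp
      then have "dist (h ?y) (h x) < \<epsilon> / 4" using sub y x by (intro uc) auto
      then show ?thesis using False by (simp add: \<alpha>_def dist_real_def)
    qed
    have int_bound: "integrable P g" if "g \<in> borel_measurable P" "AE x in P. \<bar>g x\<bar> \<le> K" for g :: "'b \<Rightarrow> real" and K
      using that by (intro integrable_const_bound[of _ K]) auto
    have i1: "integrable P (\<lambda>x. \<bar>\<alpha> (\<kappa> x) - h x\<bar>)"
    proof (rule int_bound[of _ "2 * \<bar>B\<bar>"])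
      have "\<bar>\<bar>\<alpha> (\<kappa> x) - h x\<bar>\<bar> \<le> 2 * \<bar>B\<bar>" for x
        using h(2)[of x] h(2)[of "SOME y. y \<in> A n (\<kappa> x)"] unfolding \<alpha>_def by linarith
      then show "AE x in P. \<bar>\<bar>\<alpha> (\<kappa> x) - h x\<bar>\<bar> \<le> 2 * \<bar>B\<bar>" by simp
    qed measurable
    have i2: "integrable P (\<lambda>x. \<bar>h x - f x\<bar>)"
    proof (rule int_bound[of _ "2 * \<bar>B\<bar>"])
      show "AE x in P. \<bar>\<bar>h x - f x\<bar>\<bar> \<le> 2 * \<bar>B\<bar>"
        using B
      proof eventually_elim
        case (elim x)
        then show ?case using h(2)[of x] by linarith
      qed
    qed measurable
    have "(\<integral>x. \<bar>\<alpha> (\<kappa> x) - f x\<bar> \<partial>P) \<le> (\<integral>x. \<bar>\<alpha> (\<kappa> x) - h x\<bar> + \<bar>h x - f x\<bar> \<partial>P)"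
      by (intro integral_mono_AE' Bochner_Integration.integrable_add i1 i2) auto
    also have "\<dots> = (\<integral>x. \<bar>\<alpha> (\<kappa> x) - h x\<bar> \<partial>P) + (\<integral>x. \<bar>h x - f x\<bar> \<partial>P)"
      by (rule Bochner_Integration.integral_add[OF i1 i2])
    also have "(\<integral>x. \<bar>\<alpha> (\<kappa> x) - h x\<bar> \<partial>P) \<le> (\<integral>x. \<epsilon> / 4 + 2 * \<bar>B\<bar> * indicator (E n) x \<partial>P)"
    proof (rule integral_mono_AE[OF i1])
      show "AE x in P. \<bar>\<alpha> (\<kappa> x) - h x\<bar> \<le> \<epsilon> / 4 + 2 * \<bar>B\<bar> * indicator (E n) x"
        using \<X>(2) by eventually_elim (rule ptw)
    qed (auto simp: less_top[symmetric])
    also have "\<dots> = \<epsilon> / 4 + 2 * \<bar>B\<bar> * measure P (E n)"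
      by (subst Bochner_Integration.integral_add) (auto simp: less_top[symmetric] prob_space)
    finally have "(\<integral>x. \<bar>\<alpha> (\<kappa> x) - f x\<bar> \<partial>P) < \<epsilon>" using elim(1) hf by linarith
    moreover have "\<forall>j. \<bar>\<alpha> j\<bar> \<le> \<bar>B\<bar>" using h(2) by (simp add: \<alpha>_def)
    ultimately show ?case unfolding \<kappa>_def by blast
  qed
qed

section \<open>Size of the remainder and of the approximation error\<close>

lemma card_times_min_cell_measure_le:
  fixes C :: "nat \<Rightarrow> 'b::euclidean_space set"
  assumes \<X>: "compact \<X>" and meas: "\<And>j. j \<in> {1..k} \<Longrightarrow> C j \<in> sets borel"
    and disj: "disjoint_family_on C {1..k}" and cover: "(\<Union>j\<in>{1..k}. C j) = \<X>"
    and v: "\<And>j. j \<in> {1..k} \<Longrightarrow> v \<le> measure lborel (C j)"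
  shows "real k * v \<le> measure lborel \<X>"
proof -
  have fin: "emeasure lborel (C j) \<noteq> \<infinity>" if "j \<in> {1..k}" for j
  proof -
    have "emeasure lborel (C j) \<le> emeasure lborel \<X>"
      using that cover \<X> by (intro emeasure_mono) (auto intro: borel_compact)
    also have "\<dots> < \<infinity>" using emeasure_compact_finite[OF \<X>] by simp
    finally show ?thesis by simp
  qed
  have "real k * v = (\<Sum>j\<in>{1..k}. v)" by simp
  also have "\<dots> \<le> (\<Sum>j\<in>{1..k}. measure lborel (C j))" by (intro sum_mono v)
  also have "\<dots> = measure lborel (\<Union>j\<in>{1..k}. C j)"
    using meas fin disj by (intro measure_finite_Union[symmetric]) auto
  finally show ?thesis unfolding cover .
qed

lemma density_lower_bound_mass:
  fixes g :: "'b::euclidean_space \<Rightarrow> real"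
  assumes P: "prob_space P" "P = density lborel (\<lambda>x. ennreal (g x))"
    and g: "g \<in> borel_measurable borel" "\<And>x. x \<in> S \<Longrightarrow> m \<le> g x" and m: "m \<ge> 0"
    and S: "S \<in> sets borel" "v \<le> measure lborel S" and fin: "emeasure lborel S \<noteq> \<infinity>"
  shows "m * v \<le> 1"
proof -
  have "ennreal (m * measure lborel S) = (\<integral>\<^sup>+x. ennreal m * indicator S x \<partial>lborel)"
    using S fin m by (subst nn_integral_cmult_indicator) (auto simp: ennreal_mult emeasure_eq_ennreal_measure)
  also have "\<dots> \<le> (\<integral>\<^sup>+x. ennreal (g x) * indicator S x \<partial>lborel)"
    using g(2) by (intro nn_integral_mono) (auto simp: indicator_def intro: ennreal_leI)
  also have "\<dots> = emeasure P S" using g S by (simp add: P(2) emeasure_density)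
  also have "\<dots> \<le> 1" by (rule prob_space.emeasure_le_1[OF P(1)])
  finally have "m * measure lborel S \<le> 1" by simp
  moreover have "m * v \<le> m * measure lborel S" using S m by (intro mult_left_mono)
  ultimately show ?thesis by simp
qed

text \<open>
  By \<open>(x + y)\<^sup>2 \<le> 2 * x\<^sup>2 + 2 * y\<^sup>2\<close> and \<open>N n \<le> \<Lambda> / v n\<close> the remainder is at most
  \<open>2 * \<Lambda> * (L n)\<^sup>2 / (n * v n * \<gamma> n) + 8 * \<Lambda> * m / (n * v n)\<close>.
\<close>

lemma leave_one_out_rate_tendsto_0:
  fixes N :: "nat \<Rightarrow> nat" and v \<gamma> L :: "nat \<Rightarrow> real"
  assumes v: "\<And>n. n \<ge> 1 \<Longrightarrow> v n > 0" and \<gamma>: "\<And>n. n \<ge> 1 \<Longrightarrow> \<gamma> n > 0"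
    and count: "\<And>n. n \<ge> 1 \<Longrightarrow> real (N n) * v n \<le> \<Lambda>" and m: "m \<ge> 0"
    and N: "filterlim N at_top sequentially"
    and logN: "(\<lambda>n. ln (real (N n)) / (real n * v n)) \<longlonglongrightarrow> 0"
    and L: "(\<lambda>n. 1 / sqrt (real n * v n * \<gamma> n) * L n) \<longlonglongrightarrow> 0"
  shows "(\<lambda>n. real (N n) * ((L n + 2 * \<gamma> n * sqrt (m / \<gamma> n))\<^sup>2 / \<gamma> n) / real (Suc n)) \<longlonglongrightarrow> 0"
proof -
  have "filterlim (\<lambda>n. ln (real (N n))) at_top sequentially"
    by (rule filterlim_compose[OF ln_at_top filterlim_compose[OF filterlim_real_sequentially N]])
  then have ln1: "eventually (\<lambda>n. ln (real (N n)) \<ge> 1) sequentially"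
    by (simp add: filterlim_at_top)
  have nv: "(\<lambda>n. 1 / (real n * v n)) \<longlonglongrightarrow> 0"
  proof (rule tendsto_sandwich[OF _ _ tendsto_const logN])
    show "eventually (\<lambda>n. 0 \<le> 1 / (real n * v n)) sequentially"
      using eventually_ge_at_top[of 1]
    proof eventually_elim
      case (elim n)
      then show ?case using v[of n] by simp
    qed
    show "eventually (\<lambda>n. 1 / (real n * v n) \<le> ln (real (N n)) / (real n * v n)) sequentially"
      using ln1 eventually_ge_at_top[of 1]
    proof eventually_elim
      case (elim n)
      then show ?case using v[of n] by (intro divide_right_mono) auto
    qed
  qed
  let ?u = "\<lambda>n. 2 * \<Lambda> * (1 / sqrt (real n * v n * \<gamma> n) * L n)\<^sup>2 + 8 * \<Lambda> * m * (1 / (real n * v n))"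
  have "?u \<longlonglongrightarrow> 2 * \<Lambda> * 0\<^sup>2 + 8 * \<Lambda> * m * 0"
    by (intro tendsto_intros L nv)
  then have u: "?u \<longlonglongrightarrow> 0" by simp
  show ?thesis
  proof (rule tendsto_sandwich[OF _ _ tendsto_const u])
    show "eventually (\<lambda>n. 0 \<le> real (N n) * ((L n + 2 * \<gamma> n * sqrt (m / \<gamma> n))\<^sup>2 / \<gamma> n) / real (Suc n)) sequentially"
      using eventually_ge_at_top[of 1]
    proof eventually_elim
      case (elim n)
      then show ?case using \<gamma>[of n] by simp
    qed
    show "eventually (\<lambda>n. real (N n) * ((L n + 2 * \<gamma> n * sqrt (m / \<gamma> n))\<^sup>2 / \<gamma> n) / real (Suc n) \<le> ?u n) sequentially"
      using eventually_ge_at_top[of 1]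
    proof eventually_elim
      case (elim n)
      have pos: "v n > 0" "\<gamma> n > 0" "real n > 0" using v \<gamma> elim by auto
      define s where "s = sqrt (m / \<gamma> n)"
      have "\<gamma> n * s\<^sup>2 = m" using pos m by (simp add: s_def)
      then have s: "(2 * \<gamma> n * s)\<^sup>2 = 4 * \<gamma> n * m" by (simp add: power2_eq_square algebra_simps)
      have "(L n + 2 * \<gamma> n * s)\<^sup>2 \<le> 2 * (L n)\<^sup>2 + 2 * (2 * \<gamma> n * s)\<^sup>2"
        using zero_le_power2[of "L n - 2 * \<gamma> n * s"] by (simp add: power2_sum power2_diff)
      also have "\<dots> = 2 * (L n)\<^sup>2 + 8 * \<gamma> n * m" unfolding s by simp
      finally have K: "(L n + 2 * \<gamma> n * s)\<^sup>2 / \<gamma> n \<le> (2 * (L n)\<^sup>2 + 8 * \<gamma> n * m) / \<gamma> n"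
        using pos by (intro divide_right_mono) auto
      have Nv: "real (N n) \<le> \<Lambda> / v n" using count[OF elim] pos by (simp add: field_simps)
      have "real (N n) * ((L n + 2 * \<gamma> n * s)\<^sup>2 / \<gamma> n) \<le> \<Lambda> / v n * ((2 * (L n)\<^sup>2 + 8 * \<gamma> n * m) / \<gamma> n)"
        using pos Nv K order_trans[OF _ Nv, of 0] by (intro mult_mono) auto
      then have "real (N n) * ((L n + 2 * \<gamma> n * s)\<^sup>2 / \<gamma> n) / real (Suc n)
          \<le> \<Lambda> / v n * ((2 * (L n)\<^sup>2 + 8 * \<gamma> n * m) / \<gamma> n) / real n"
        using pos by (intro frac_le) (auto intro: order_trans[rotated])
      also have "\<dots> = ?u n"
        using pos by (simp add: power_mult_distrib power_divide field_simps)
      finally show ?case by (simp add: s_def)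
    qed
  qed
qed

text \<open>
  Both functions take values in a ball on which the loss is Lipschitz, so passing from \<open>a\<close> to \<open>f\<close>
  costs only an \<open>L\<^sup>1\<close> distance, and the penalty is at most \<open>c * B\<^sup>2\<close>.
\<close>

lemma expected_pen_loss_le_risk:
  assumes M: "prob_space M" and XY: "X' \<in> borel_measurable M"
    and a: "a \<in> borel_measurable borel" and f: "f \<in> borel_measurable borel"
    and loss_f: "(\<lambda>\<omega>. \<phi> (f (X' \<omega>)) (Y' \<omega>)) \<in> borel_measurable M"
    and nonneg: "\<And>\<omega> x. \<omega> \<in> space M \<Longrightarrow> \<phi> x (Y' \<omega>) \<ge> 0"
    and lip: "\<And>\<omega> x x'. \<omega> \<in> space M \<Longrightarrow> \<bar>x\<bar> \<le> B \<Longrightarrow> \<bar>x'\<bar> \<le> B \<Longrightarrow>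
                \<bar>\<phi> x (Y' \<omega>) - \<phi> x' (Y' \<omega>)\<bar> \<le> L * \<bar>x - x'\<bar>"
    and L: "L \<ge> 0" and c: "c > 0"
    and aB: "AE x in distr M borel X'. \<bar>a x\<bar> \<le> B" and fB: "AE x in distr M borel X'. \<bar>f x\<bar> \<le> B"
  shows "(\<integral>\<^sup>+\<omega>. ennreal (pen_loss \<phi> c (a (X' \<omega>)) (Y' \<omega>)) \<partial>M)
    \<le> risk M \<phi> X' Y' f + ennreal (L * (\<integral>x. \<bar>a x - f x\<bar> \<partial>distr M borel X') + c * B\<^sup>2)"
proof -
  interpret prob_space M by fact
  let ?P = "distr M borel X'"
  interpret P: prob_space ?P by (rule prob_space_distr[OF XY])
  have [measurable]: "a \<in> borel_measurable ?P" "f \<in> borel_measurable ?P" using a f by auto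
  define e where "e x = L * \<bar>a x - f x\<bar> + c * B\<^sup>2" for x
  have e_meas[measurable]: "e \<in> borel_measurable borel" unfolding e_def[abs_def] using a f by measurable
  have e0: "e x \<ge> 0" for x unfolding e_def using L c by simp
  have int: "integrable ?P (\<lambda>x. \<bar>a x - f x\<bar>)"
  proof (rule P.integrable_const_bound[of _ "2 * B"])
    show "AE x in ?P. norm \<bar>a x - f x\<bar> \<le> 2 * B"
      using aB fB
    proof eventually_elim
      case (elim x)
      then have "\<bar>a x - f x\<bar> \<le> 2 * B" by linarith
      then show ?case by simp
    qed
  qed measurable
  have "AE \<omega> in M. \<bar>a (X' \<omega>)\<bar> \<le> B" "AE \<omega> in M. \<bar>f (X' \<omega>)\<bar> \<le> B"
    using AE_distrD[OF XY aB] AE_distrD[OF XY fB] by auto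
  then have "AE \<omega> in M. ennreal (pen_loss \<phi> c (a (X' \<omega>)) (Y' \<omega>))
      \<le> ennreal (\<phi> (f (X' \<omega>)) (Y' \<omega>)) + ennreal (e (X' \<omega>))"
    using AE_space
  proof eventually_elim
    case (elim \<omega>)
    have "(a (X' \<omega>))\<^sup>2 \<le> B\<^sup>2" using elim(1) by (metis abs_ge_zero power2_abs power_mono)
    then have "c * (a (X' \<omega>))\<^sup>2 \<le> c * B\<^sup>2" using c by simp
    then have "pen_loss \<phi> c (a (X' \<omega>)) (Y' \<omega>) \<le> \<phi> (f (X' \<omega>)) (Y' \<omega>) + e (X' \<omega>)"
      using lip[OF elim(3,1,2)] unfolding pen_loss_def e_def by linarith
    then have "ennreal (pen_loss \<phi> c (a (X' \<omega>)) (Y' \<omega>)) \<le> ennreal (\<phi> (f (X' \<omega>)) (Y' \<omega>) + e (X' \<omega>))"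
      by (rule ennreal_leI)
    also have "\<dots> = ennreal (\<phi> (f (X' \<omega>)) (Y' \<omega>)) + ennreal (e (X' \<omega>))"
      using nonneg elim(3) e0 by (intro ennreal_plus) auto
    finally show ?case .
  qed
  then have "(\<integral>\<^sup>+\<omega>. ennreal (pen_loss \<phi> c (a (X' \<omega>)) (Y' \<omega>)) \<partial>M)
      \<le> (\<integral>\<^sup>+\<omega>. ennreal (\<phi> (f (X' \<omega>)) (Y' \<omega>)) + ennreal (e (X' \<omega>)) \<partial>M)"
    by (rule nn_integral_mono_AE)
  also have "\<dots> = risk M \<phi> X' Y' f + (\<integral>\<^sup>+\<omega>. ennreal (e (X' \<omega>)) \<partial>M)"
    unfolding risk_def using loss_f measurable_compose[OF XY e_meas]
    by (intro nn_integral_add) auto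
  also have "(\<integral>\<^sup>+\<omega>. ennreal (e (X' \<omega>)) \<partial>M) = (\<integral>\<^sup>+x. ennreal (e x) \<partial>?P)"
    using XY by (intro nn_integral_distr[symmetric]) auto
  also have "\<dots> = ennreal (\<integral>x. e x \<partial>?P)"
    using e0 int by (intro nn_integral_eq_integral) (auto simp: e_def)
  also have "(\<integral>x. e x \<partial>?P) = L * (\<integral>x. \<bar>a x - f x\<bar> \<partial>?P) + c * B\<^sup>2"
    unfolding e_def using int P.prob_space by simp
  finally show ?thesis .
qed

section \<open>Consistency\<close>

theorem theorem4p1:
  fixes M :: "'a measure"
    and \<X> :: "(real ^ 'd) set" and \<Y> :: "real set"
    and X :: "nat \<Rightarrow> 'a \<Rightarrow> real ^ 'd" and Y :: "nat \<Rightarrow> 'a \<Rightarrow> real"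
    and P :: "(real ^ 'd) measure" and g :: "real ^ 'd \<Rightarrow> real"
    and \<F> :: "nat \<Rightarrow> (real ^ 'd \<Rightarrow> real) set"
    and N :: "nat \<Rightarrow> nat" and A :: "nat \<Rightarrow> nat \<Rightarrow> (real ^ 'd) set"
    and v :: "nat \<Rightarrow> real" and \<gamma> :: "nat \<Rightarrow> real"
    and \<phi> :: "real \<Rightarrow> real \<Rightarrow> real" and \<xi> :: "nat \<Rightarrow> real \<Rightarrow> real \<Rightarrow> real"
    and \<zeta> :: "real \<Rightarrow> real"
    and Fbar :: "nat \<Rightarrow> 'a \<Rightarrow> real ^ 'd \<Rightarrow> real" and Fstar :: "real ^ 'd \<Rightarrow> real"
  assumes prob: "prob_space M"
    \<comment> \<open>the data\<close>
    and X_compact: "compact \<X>"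
    and data_vals: "\<forall>i\<ge>1. \<forall>\<omega>\<in>space M. X i \<omega> \<in> \<X> \<and> Y i \<omega> \<in> \<Y>"
    and data_indep: "prob_space.indep_vars M (\<lambda>_. borel) (\<lambda>i \<omega>. (X i \<omega>, Y i \<omega>)) {1..}"
    and data_ident: "\<forall>i\<ge>1. distr M borel (\<lambda>\<omega>. (X i \<omega>, Y i \<omega>)) = distr M borel (\<lambda>\<omega>. (X 1 \<omega>, Y 1 \<omega>))"
    and P_def: "P = distr M borel (X 1)"
    and g_nonneg: "\<forall>x. g x \<ge> 0"
    and g_density: "distributed M lborel (X 1) (\<lambda>x. ennreal (g x))"
    and g_inf: "0 < (INF x\<in>\<X>. g x)"
    and g_sup: "bdd_above (g ` \<X>)"
    \<comment> \<open>the classes of weak learners and the associated partitions\<close>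
    and class_finite: "\<forall>n\<ge>1. finite (\<F> n)"
    and class_zero: "\<forall>n\<ge>1. (\<lambda>x. 0) \<in> \<F> n"
    and class_simple: "\<forall>n\<ge>1. \<forall>f\<in>\<F> n. simple_function borel f"
    and class_vals: "\<forall>n\<ge>1. \<forall>f\<in>\<F> n. f = (\<lambda>x. 0) \<or> ((\<forall>x\<in>\<X>. f x \<in> {-1, 1}) \<and> (\<forall>x. x \<notin> \<X> \<longrightarrow> f x = 0))"
    and class_sym: "\<forall>n\<ge>1. \<forall>f. f \<in> \<F> n \<longleftrightarrow> (\<lambda>x. - f x) \<in> \<F> n"
    and N_pos: "\<forall>n\<ge>1. N n \<ge> 1"
    and cells_meas: "\<forall>n\<ge>1. \<forall>j\<in>{1..N n}. A n j \<in> sets borel"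
    and cells_disj: "\<forall>n\<ge>1. disjoint_family_on (A n) {1..N n}"
    and cells_cover: "\<forall>n\<ge>1. (\<Union>j\<in>{1..N n}. A n j) = \<X>"
    and lin_form: "\<forall>n\<ge>1. lin (\<F> n) = step_functions (N n) (A n)"
    and v_pos: "\<forall>n\<ge>1. v n > 0"
    and cells_v: "\<forall>n\<ge>1. \<forall>j\<in>{1..N n}. measure lborel (A n j) \<ge> v n"
    \<comment> \<open>the loss, the penalty, the predictor and the optimal function\<close>
    and loss_nonneg: "\<forall>y\<in>\<Y>. \<forall>x. \<phi> x y \<ge> 0"
    and loss_meas: "(\<lambda>(x, y). \<phi> x y) \<in> borel_measurable (restrict_space borel (UNIV \<times> \<Y>))"
    and loss_convex: "\<forall>y\<in>\<Y>. convex_on UNIV (\<lambda>x. \<phi> x y)"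
    and loss_bdd: "bdd_above ((\<lambda>y. \<phi> 0 y) ` \<Y>)"
    and \<gamma>_pos: "\<forall>n\<ge>1. \<gamma> n > 0"
    and Fbar: "\<forall>n\<ge>1. \<forall>\<omega>\<in>space M. is_predictor \<phi> \<gamma> X Y (\<F> n) (N n) (A n) n \<omega> (Fbar n \<omega>)"
    and risk_locally_bounded: "locally_bounded_L2 P (risk M \<phi> (X 1) (Y 1))"
    and Fstar: "is_arg_min (risk M \<phi> (X 1) (Y 1)) (\<lambda>F. F \<in> L2 P) Fstar"
    \<comment> \<open>assumption (i)\<close>
    and subgrad: "\<forall>n\<ge>1. \<forall>y\<in>\<Y>. is_subgradient (\<lambda>x. pen_loss \<phi> (\<gamma> n) x y) (\<lambda>x. \<xi> n x y)"
    and subgrad_lipschitz: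
      "\<forall>n\<ge>1. AE \<omega> in M. \<exists>L>0. \<forall>x1 x2. AE z in emp_measure X Y n \<omega>.
         \<bar>emp_cond_exp X Y n \<omega> (\<lambda>y. \<xi> n x1 y - \<xi> n x2 y) z\<bar> \<le> L * \<bar>x1 - x2\<bar>"
    \<comment> \<open>assumption (ii)\<close>
    and \<zeta>_pos: "\<forall>p\<ge>0. \<zeta> p > 0"
    and loss_lipschitz:
      "\<forall>p\<ge>0. \<forall>x1 x2. \<forall>y\<in>\<Y>. max \<bar>x1\<bar> \<bar>x2\<bar> \<le> p \<longrightarrow> \<bar>\<phi> x1 y - \<phi> x2 y\<bar> \<le> \<zeta> p * \<bar>x1 - x2\<bar>"
    \<comment> \<open>assumption (iii); \<open>Fstar\<close> represents an element of \<open>L\<^sup>2(P)\<close>\<close>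
    and Fstar_bounded: "\<exists>B. AE x in P. \<bar>Fstar x\<bar> \<le> B"
    \<comment> \<open>assumption (iv)\<close>
    and diam_in_prob:
      "\<forall>\<epsilon>>0. (\<lambda>n. measure P {x \<in> space P. diameter (cell (N n) (A n) x) > \<epsilon>}) \<longlonglongrightarrow> 0"
    \<comment> \<open>the limit conditions\<close>
    and \<gamma>_lim: "\<gamma> \<longlonglongrightarrow> 0"
    and N_lim: "filterlim N at_top sequentially"
    and logN_lim: "(\<lambda>n. ln (real (N n)) / (real n * v n)) \<longlonglongrightarrow> 0"
    and \<zeta>_lim:
      "(\<lambda>n. 1 / sqrt (real n * v n * \<gamma> n) *
          \<zeta> (sqrt (2 * (SUP y\<in>\<Y>. \<phi> 0 y) / (v n * \<gamma> n * (INF x\<in>\<X>. g x))))) \<longlonglongrightarrow> 0"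
  shows "(\<lambda>n. \<integral>\<^sup>+\<omega>. risk M \<phi> (X 1) (Y 1) (Fbar n \<omega>) \<partial>M) \<longlonglongrightarrow> risk M \<phi> (X 1) (Y 1) Fstar"
proof -
  interpret prob_space M by fact
  \<comment> \<open>The loss is measurable only as a function of labels in \<open>\<Y>\<close>, which need not be a Borel set. The
      observations are therefore regarded as elements of the trace space on \<open>\<X> \<times> \<Y>\<close>.\<close>
  define E where "E = restrict_space (borel :: ((real ^ 'd) \<times> real) measure) (\<X> \<times> \<Y>)"
  define Z where "Z i \<omega> = (X i \<omega>, Y i \<omega>)" for i \<omega>
  define D where "D = distr M E (Z 1)"
  define \<phi>bar where "\<phi>bar = (SUP y\<in>\<Y>. \<phi> 0 y)"
  define G where "G = (INF x\<in>\<X>. g x)"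
  define L where "L n = \<zeta> (sqrt (2 * \<phi>bar / (v n * \<gamma> n * G)))" for n
  define \<kappa> where "\<kappa> n = cell_index (N n) (A n)" for n
  let ?R = "risk M \<phi> (X 1) (Y 1)"

  obtain \<omega>0 where \<omega>0: "\<omega>0 \<in> space M" using not_empty by blast
  have \<phi>0: "\<phi> 0 y \<le> \<phi>bar" if "y \<in> \<Y>" for y
    unfolding \<phi>bar_def using loss_bdd that by (intro cSUP_upper)
  have \<phi>bar: "\<phi>bar \<ge> 0"
    using \<phi>0[of "Y 1 \<omega>0"] loss_nonneg data_vals \<omega>0 by (meson order_refl order_trans)
  have E: "space E = \<X> \<times> \<Y>" by (simp add: E_def space_restrict_space)
  have Z_rv: "Z i \<in> measurable M borel" if "i \<ge> 1" for i
    using data_indep that by (simp add: indep_vars_def2 Z_def[abs_def])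
  have Z_val: "Z i \<omega> \<in> \<X> \<times> \<Y>" if "i \<ge> 1" "\<omega> \<in> space M" for i \<omega>
    using data_vals that by (simp add: Z_def)
  have Z_E: "Z i \<in> measurable M E" if "i \<ge> 1" for i
    unfolding E_def using Z_rv[OF that] Z_val[OF that] by (intro measurable_restrict_space2) auto
  have Z_indep: "indep_vars (\<lambda>_. E) Z {1..}"
    unfolding E_def by (rule indep_vars_restrict_space) (use data_indep Z_val in \<open>auto simp: Z_def[abs_def]\<close>)
  have Z_ident: "distr M E (Z i) = D" if "i \<ge> 1" for i
    unfolding D_def E_def
  proof (rule distr_restrict_space_cong)
    show "distr M borel (Z i) = distr M borel (Z 1)"
      using data_ident that unfolding Z_def[abs_def] by blast
  qed (use Z_rv Z_val that in auto)
  have X1: "X 1 \<in> borel_measurable M"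
    using measurable_compose[OF Z_rv[of 1] borel_measurable_continuous_onI[OF continuous_on_fst[OF continuous_on_id]]]
    by (simp add: Z_def)
  have fst_E: "fst \<in> measurable E borel" and snd_E: "snd \<in> measurable E borel"
    unfolding E_def by (auto intro!: measurable_restrict_space1 borel_measurable_continuous_onI continuous_intros)
  have loss_E: "(\<lambda>(s, w). \<phi> s (snd w)) \<in> borel_measurable (borel \<Otimes>\<^sub>M E)"
  proof -
    have "(\<lambda>x. (fst x, snd (snd x))) \<in> measurable (borel \<Otimes>\<^sub>M E) (borel \<Otimes>\<^sub>M borel :: (real \<times> real) measure)"
      using measurable_compose[OF measurable_snd snd_E] by (intro measurable_Pair measurable_fst) auto
    then have "(\<lambda>x. (fst x, snd (snd x))) \<in> measurable (borel \<Otimes>\<^sub>M E) (restrict_space borel ((UNIV :: real set) \<times> \<Y>))"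
      unfolding borel_prod by (intro measurable_restrict_space2) (auto simp: space_pair_measure E)
    from measurable_compose[OF this loss_meas] show ?thesis by (simp add: case_prod_beta')
  qed
  have loss_cv: "convex_on UNIV (\<lambda>x. \<phi> x (snd w))" and loss_nn: "\<phi> x (snd w) \<ge> 0"
    and loss_b: "\<phi> 0 (snd w) \<le> \<phi>bar" if "w \<in> space E" for w x
    using that loss_convex loss_nonneg \<phi>0 by (auto simp: E)

  have P: "prob_space P" "sets P = sets borel"
    unfolding P_def using X1 by (auto intro: prob_space_distr)
  interpret P: prob_space P by (rule P(1))
  have P_dens: "P = density lborel (\<lambda>x. ennreal (g x))"
  proof -
    have "P = distr M lborel (X 1)" unfolding P_def by (intro distr_cong) auto
    then show ?thesis using g_density by (simp add: distributed_def)
  qed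
  have g_meas: "g \<in> borel_measurable borel"
  proof -
    have "(\<lambda>x. ennreal (g x)) \<in> borel_measurable lborel" using g_density by (simp add: distributed_def)
    then have "(\<lambda>x. enn2real (ennreal (g x))) \<in> borel_measurable lborel" by (rule borel_measurable_enn2real)
    then show ?thesis using g_nonneg by simp
  qed
  have ac: "absolutely_continuous lborel P"
    unfolding P_dens by (rule absolutely_continuousI_density) (use g_meas in simp)
  have AE_\<X>: "AE x in P. x \<in> \<X>"
    unfolding P_def using X1 data_vals X_compact by (subst AE_distr_iff) (auto intro: borel_compact)
  have g_ge: "G \<le> g x" if "x \<in> \<X>" for x
    unfolding G_def using that g_nonneg by (intro cINF_lower bdd_belowI2[of _ 0]) auto
  have G: "G > 0" using g_inf by (simp add: G_def)

  have Nv: "real (N n) * v n \<le> measure lborel \<X>" if "n \<ge> 1" for n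
    using that cells_meas cells_disj cells_cover cells_v
    by (intro card_times_min_cell_measure_le[OF X_compact, of _ "A n"]) auto
  \<comment> \<open>The cellwise minimizers are bounded by the left-hand side, which uses only the penalty. The
      factor \<open>2 / (v n * G)\<close> on the right-hand side is at least 1, as a cell has mass at most 1.\<close>
  have radius: "sqrt (\<phi>bar / \<gamma> n) \<le> sqrt (2 * \<phi>bar / (v n * \<gamma> n * G))" if n: "n \<ge> 1" for n
  proof -
    have one: "1 \<in> {1..N n}" using N_pos n by auto
    have sub: "A n 1 \<subseteq> \<X>" using cells_cover n one by blast
    have "emeasure lborel (A n 1) \<le> emeasure lborel \<X>"
      using sub X_compact by (intro emeasure_mono) (auto intro: borel_compact)
    also have "\<dots> < \<infinity>" using emeasure_compact_finite[OF X_compact] by simp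
    finally have fin: "emeasure lborel (A n 1) \<noteq> \<infinity>" by simp
    have "G * v n \<le> 1"
      by (rule density_lower_bound_mass[OF P(1) P_dens g_meas, of "A n 1"])
        (use sub g_ge G cells_meas cells_v n one fin in auto)
    then have "\<phi>bar * (v n * G) \<le> \<phi>bar * 2" using \<phi>bar by (intro mult_left_mono) (auto simp: mult.commute)
    moreover have "\<gamma> n > 0" "v n > 0" using \<gamma>_pos v_pos n by auto
    ultimately have "\<phi>bar / \<gamma> n \<le> 2 * \<phi>bar / (v n * \<gamma> n * G)"
      using G by (simp add: field_simps)
    then show ?thesis by simp
  qed
  have loss_lip: "\<bar>\<phi> b (snd w) - \<phi> a (snd w)\<bar> \<le> L n * \<bar>b - a\<bar>"
    if "n \<ge> 1" "w \<in> space E" "\<bar>a\<bar> \<le> sqrt (\<phi>bar / \<gamma> n)" "\<bar>b\<bar> \<le> sqrt (\<phi>bar / \<gamma> n)" for n w a b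
  proof -
    have "sqrt (2 * \<phi>bar / (v n * \<gamma> n * G)) \<ge> 0"
      using radius[OF that(1)] that(3) by linarith
    moreover have "max \<bar>b\<bar> \<bar>a\<bar> \<le> sqrt (2 * \<phi>bar / (v n * \<gamma> n * G))"
      using radius[OF that(1)] that(3,4) by (meson max.boundedI order_trans)
    ultimately show ?thesis unfolding L_def using loss_lipschitz that(2) by (auto simp: E)
  qed
  have \<kappa>_E: "(\<lambda>w. \<kappa> n (fst w)) \<in> measurable E (count_space UNIV)" if "n \<ge> 1" for n
    by (rule measurable_compose[OF fst_E]) (use that cells_meas in \<open>auto simp: \<kappa>_def intro!: cell_index_measurable\<close>)
  have \<kappa>_in: "\<kappa> n x \<in> {1..N n}" "x \<in> A n (\<kappa> n x)" if "n \<ge> 1" "x \<in> \<X>" for n x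
  proof -
    have "x \<in> (\<Union>j\<in>{1..N n}. A n j)" using cells_cover that by blast
    then show "\<kappa> n x \<in> {1..N n}" "x \<in> A n (\<kappa> n x)"
      unfolding \<kappa>_def by (rule cell_index_in)+
  qed
  have \<kappa>_borel: "(\<lambda>x. \<alpha> (\<kappa> n x) :: real) \<in> borel_measurable borel" if "n \<ge> 1" for n \<alpha>
    by (rule measurable_compose[of "\<kappa> n" _ "count_space UNIV"])
      (use that cells_meas in \<open>auto simp: \<kappa>_def intro!: cell_index_measurable\<close>)

  define fit where
    "fit n \<omega> = cell_fit \<phi> (\<gamma> n) (\<lambda>w. \<kappa> n (fst w)) snd {1..n} (\<lambda>i. Z i \<omega>)" for n \<omega>
  have Fbar_fit: "Fbar n \<omega> x = fit n \<omega> (\<kappa> n x)" if "n \<ge> 1" "\<omega> \<in> space M" "x \<in> \<X>" for n \<omega> x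
    unfolding fit_def Z_def \<kappa>_def
  proof (rule predictor_eq_cell_fit)
    show "is_predictor \<phi> \<gamma> X Y (\<F> n) (N n) (A n) n \<omega> (Fbar n \<omega>)" using Fbar that by blast
    show "X i \<omega> \<in> (\<Union>j\<in>{1..N n}. A n j)" if "i \<in> {1..n}" for i
      using data_vals cells_cover that \<open>n \<ge> 1\<close> \<open>\<omega> \<in> space M\<close> by auto
    show "convex_on UNIV (\<lambda>x. \<phi> x (Y i \<omega>))" if "i \<in> {1..n}" for i
      using data_vals loss_convex that \<open>\<omega> \<in> space M\<close> by auto
  qed (use that lin_form cells_disj \<gamma>_pos \<kappa>_in[OF that(1,3)] in \<open>auto simp: \<kappa>_def\<close>)

  have pen_loss_meas: "(\<lambda>w. pen_loss \<phi> (\<gamma> n) (\<beta> (\<kappa> n (fst w))) (snd w)) \<in> borel_measurable E"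
    if "n \<ge> 1" for n and \<beta> :: "nat \<Rightarrow> real"
  proof -
    have \<beta>: "(\<lambda>w. \<beta> (\<kappa> n (fst w))) \<in> borel_measurable E"
      by (rule measurable_compose[OF \<kappa>_E[OF that]]) simp
    have "(\<lambda>w. \<phi> (\<beta> (\<kappa> n (fst w))) (snd w)) \<in> borel_measurable E"
      using measurable_compose[OF measurable_Pair[OF \<beta> measurable_ident] loss_E] by simp
    with \<beta> show ?thesis unfolding pen_loss_def by measurable
  qed
  have transfer: "(\<integral>\<^sup>+w. ennreal (pen_loss \<phi> (\<gamma> n) (\<beta> (\<kappa> n (fst w))) (snd w)) \<partial>D)
      = (\<integral>\<^sup>+\<omega>. ennreal (pen_loss \<phi> (\<gamma> n) (\<beta> (\<kappa> n (X 1 \<omega>))) (Y 1 \<omega>)) \<partial>M)"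
    if "n \<ge> 1" for n and \<beta> :: "nat \<Rightarrow> real"
    unfolding D_def using Z_E[of 1] pen_loss_meas[OF that, of \<beta>]
    by (subst nn_integral_distr) (auto simp: Z_def)

  define rate where
    "rate n = real (N n) * ((L n + 2 * \<gamma> n * sqrt (\<phi>bar / \<gamma> n))\<^sup>2 / \<gamma> n) / real (Suc n)" for n
  have rate_lim: "rate \<longlonglongrightarrow> 0"
    unfolding rate_def[abs_def]
    by (rule leave_one_out_rate_tendsto_0[where v = v and \<Lambda> = "measure lborel \<X>"])
      (use v_pos \<gamma>_pos Nv \<phi>bar N_lim logN_lim \<zeta>_lim in \<open>auto simp: L_def \<phi>bar_def G_def\<close>)
  have rate_nonneg: "rate n \<ge> 0" if "n \<ge> 1" for n
  proof -
    have "\<gamma> n > 0" using \<gamma>_pos that by blast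
    then show ?thesis by (simp add: rate_def)
  qed

  obtain B0 where B0: "AE x in P. \<bar>Fstar x\<bar> \<le> B0" using Fstar_bounded by blast
  define B where "B = \<bar>B0\<bar>"
  have B: "AE x in P. \<bar>Fstar x\<bar> \<le> B" "B \<ge> 0" using B0 by (auto simp: B_def)
  have Fstar_L2: "Fstar \<in> L2 P" using Fstar by (simp add: is_arg_min_def)
  have Fstar_meas: "Fstar \<in> borel_measurable borel"
    using Fstar_L2 measurable_cong_sets[OF P(2) refl] by (auto simp: L2_def)
  have loss_Fstar: "(\<lambda>\<omega>. \<phi> (Fstar (X 1 \<omega>)) (Y 1 \<omega>)) \<in> borel_measurable M"
    using measurable_compose[OF measurable_Pair[OF measurable_compose[OF X1 Fstar_meas] Z_E[of 1]] loss_E]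
    by (simp add: Z_def)

  \<comment> \<open>The fitted function is compared with the step function of heights \<open>\<alpha>\<close>; the error terms are
      due to approximation, penalty and estimation.\<close>
  have risk_bound: "(\<integral>\<^sup>+\<omega>. ?R (Fbar n \<omega>) \<partial>M)
      \<le> ?R Fstar + ennreal (\<zeta> B * (\<integral>x. \<bar>\<alpha> (\<kappa> n x) - Fstar x\<bar> \<partial>P) + \<gamma> n * B\<^sup>2 + rate n)"
    if n: "n \<ge> 1" and \<alpha>: "\<And>j. \<bar>\<alpha> j\<bar> \<le> B" for n and \<alpha> :: "nat \<Rightarrow> real"
  proof -
    have \<gamma>n: "\<gamma> n > 0" using \<gamma>_pos n by simp
    have "?R (Fbar n \<omega>) \<le> (\<integral>\<^sup>+w. ennreal (pen_loss \<phi> (\<gamma> n) (fit n \<omega> (\<kappa> n (fst w))) (snd w)) \<partial>D)"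
      if \<omega>: "\<omega> \<in> space M" for \<omega>
      unfolding transfer[OF n, of "fit n \<omega>"] risk_def
    proof (intro nn_integral_mono ennreal_leI)
      fix \<omega>' assume "\<omega>' \<in> space M"
      then have "Fbar n \<omega> (X 1 \<omega>') = fit n \<omega> (\<kappa> n (X 1 \<omega>'))"
        using data_vals by (intro Fbar_fit[OF n \<omega>]) simp
      then show "\<phi> (Fbar n \<omega> (X 1 \<omega>')) (Y 1 \<omega>')
          \<le> pen_loss \<phi> (\<gamma> n) (fit n \<omega> (\<kappa> n (X 1 \<omega>'))) (Y 1 \<omega>')"
        using \<gamma>n by (simp add: pen_loss_def)
    qed
    then have "(\<integral>\<^sup>+\<omega>. ?R (Fbar n \<omega>) \<partial>M)
        \<le> (\<integral>\<^sup>+\<omega>. \<integral>\<^sup>+w. ennreal (pen_loss \<phi> (\<gamma> n) (fit n \<omega> (\<kappa> n (fst w))) (snd w)) \<partial>D \<partial>M)"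
      by (intro nn_integral_mono)
    also have "\<dots> \<le> (\<integral>\<^sup>+w. ennreal (pen_loss \<phi> (\<gamma> n) (\<alpha> (\<kappa> n (fst w))) (snd w)) \<partial>D) + ennreal (rate n)"
      unfolding fit_def rate_def
    proof (rule expected_pen_loss_iid[OF prob n \<gamma>n \<phi>bar Z_indep Z_ident \<kappa>_E[OF n] _ loss_E])
      show "\<kappa> n (fst w) \<in> {1..N n}" if "w \<in> space E" for w
        using that by (intro \<kappa>_in(1)[OF n]) (auto simp: E)
    qed (assumption | rule loss_cv loss_nn loss_b loss_lip[OF n])+
    finally have est: "(\<integral>\<^sup>+\<omega>. ?R (Fbar n \<omega>) \<partial>M)
        \<le> (\<integral>\<^sup>+w. ennreal (pen_loss \<phi> (\<gamma> n) (\<alpha> (\<kappa> n (fst w))) (snd w)) \<partial>D) + ennreal (rate n)" .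
    have approx: "(\<integral>\<^sup>+w. ennreal (pen_loss \<phi> (\<gamma> n) (\<alpha> (\<kappa> n (fst w))) (snd w)) \<partial>D)
        \<le> ?R Fstar + ennreal (\<zeta> B * (\<integral>x. \<bar>\<alpha> (\<kappa> n x) - Fstar x\<bar> \<partial>P) + \<gamma> n * B\<^sup>2)"
      unfolding transfer[OF n, of \<alpha>] P_def
    proof (rule expected_pen_loss_le_risk[where a = "\<lambda>x. \<alpha> (\<kappa> n x)" and f = Fstar
        and \<phi> = \<phi> and Y' = "Y 1", OF prob X1 \<kappa>_borel[OF n] Fstar_meas loss_Fstar])
      show "\<bar>\<phi> x (Y 1 \<omega>) - \<phi> x' (Y 1 \<omega>)\<bar> \<le> \<zeta> B * \<bar>x - x'\<bar>"
        if "\<omega> \<in> space M" "\<bar>x\<bar> \<le> B" "\<bar>x'\<bar> \<le> B" for \<omega> x x'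
        using loss_lipschitz B(2) data_vals that by auto
      show "\<zeta> B \<ge> 0" using \<zeta>_pos B(2) by (simp add: less_imp_le)
      show "\<phi> x (Y 1 \<omega>) \<ge> 0" if "\<omega> \<in> space M" for \<omega> x
        using loss_nonneg data_vals that by simp
      show "AE x in distr M borel (X 1). \<bar>\<alpha> (\<kappa> n x)\<bar> \<le> B" using \<alpha> by simp
      show "AE x in distr M borel (X 1). \<bar>Fstar x\<bar> \<le> B" using B(1) unfolding P_def .
    qed (fact \<gamma>n)
    define t where "t = \<zeta> B * (\<integral>x. \<bar>\<alpha> (\<kappa> n x) - Fstar x\<bar> \<partial>P) + \<gamma> n * B\<^sup>2"
    have "\<zeta> B > 0" using \<zeta>_pos B(2) by blast
    then have t: "t \<ge> 0" using \<gamma>n by (simp add: t_def)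
    have "?R Fstar + ennreal t + ennreal (rate n) = ?R Fstar + ennreal (t + rate n)"
      unfolding add.assoc by (simp only: ennreal_plus[OF t rate_nonneg[OF n]])
    with order_trans[OF est add_right_mono[OF approx]] show ?thesis
      unfolding t_def[symmetric] by (simp only:)
  qed

  have upper: "eventually (\<lambda>n. (\<integral>\<^sup>+\<omega>. ?R (Fbar n \<omega>) \<partial>M) \<le> ?R Fstar + ennreal \<epsilon>) sequentially"
    if \<epsilon>: "\<epsilon> > 0" for \<epsilon> :: real
  proof -
    have \<zeta>B: "\<zeta> B > 0" using \<zeta>_pos B(2) by blast
    have "eventually (\<lambda>n. \<exists>\<alpha>. (\<forall>j. \<bar>\<alpha> j\<bar> \<le> \<bar>B\<bar>) \<and>
        (\<integral>x. \<bar>\<alpha> (cell_index (N n) (A n) x) - Fstar x\<bar> \<partial>P) < \<epsilon> / (2 * \<zeta> B)) sequentially"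
      by (rule step_L1_approximation[OF P(1,2) ac X_compact AE_\<X> Fstar_meas B(1)])
        (use \<epsilon> \<zeta>B cells_meas cells_disj cells_cover diam_in_prob in auto)
    moreover have "eventually (\<lambda>n. \<gamma> n * B\<^sup>2 + rate n < \<epsilon> / 2) sequentially"
    proof -
      have "(\<lambda>n. \<gamma> n * B\<^sup>2 + rate n) \<longlonglongrightarrow> 0 * B\<^sup>2 + 0"
        by (intro tendsto_intros \<gamma>_lim rate_lim)
      then show ?thesis using \<epsilon> by (intro order_tendstoD) auto
    qed
    ultimately show ?thesis using eventually_ge_at_top[of 1]
    proof eventually_elim
      case (elim n)
      then obtain \<alpha> where \<alpha>: "\<And>j. \<bar>\<alpha> j\<bar> \<le> B" "(\<integral>x. \<bar>\<alpha> (\<kappa> n x) - Fstar x\<bar> \<partial>P) < \<epsilon> / (2 * \<zeta> B)"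
        using B(2) unfolding \<kappa>_def by auto
      have "\<zeta> B * (\<integral>x. \<bar>\<alpha> (\<kappa> n x) - Fstar x\<bar> \<partial>P) \<le> \<epsilon> / 2"
        using \<alpha>(2) \<zeta>B by (simp add: field_simps)
      then have "\<zeta> B * (\<integral>x. \<bar>\<alpha> (\<kappa> n x) - Fstar x\<bar> \<partial>P) + \<gamma> n * B\<^sup>2 + rate n \<le> \<epsilon>"
        using elim(2) by linarith
      then have "?R Fstar + ennreal (\<zeta> B * (\<integral>x. \<bar>\<alpha> (\<kappa> n x) - Fstar x\<bar> \<partial>P) + \<gamma> n * B\<^sup>2 + rate n)
          \<le> ?R Fstar + ennreal \<epsilon>"
        by (intro add_left_mono ennreal_leI)
      with risk_bound[OF elim(3) \<alpha>(1)] show ?case by (rule order_trans)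
    qed
  qed

  have lower: "?R Fstar \<le> (\<integral>\<^sup>+\<omega>. ?R (Fbar n \<omega>) \<partial>M)" if n: "n \<ge> 1" for n
  proof -
    have "?R Fstar \<le> ?R (Fbar n \<omega>)" if \<omega>: "\<omega> \<in> space M" for \<omega>
    proof -
      have "Fbar n \<omega> \<in> lin (\<F> n)"
        using Fbar n \<omega> by (auto simp: is_predictor_def is_arg_min_def)
      then obtain \<alpha> where F: "Fbar n \<omega> = (\<lambda>x. \<Sum>j=1..N n. \<alpha> j * indicator (A n j) x)"
        using lin_form n by (auto simp: step_functions_def)
      have F_meas: "Fbar n \<omega> \<in> borel_measurable P"
        unfolding F using cells_meas n P(2) by (intro borel_measurable_sum borel_measurable_times) auto
      have F_le: "\<bar>Fbar n \<omega> x\<bar> \<le> (\<Sum>j=1..N n. \<bar>\<alpha> j\<bar>)" for x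
        unfolding F by (rule order_trans[OF sum_abs]) (auto intro!: sum_mono simp: indicator_def)
      have "integrable P (\<lambda>x. (Fbar n \<omega> x)\<^sup>2)"
      proof (rule P.integrable_const_bound[of _ "(\<Sum>j=1..N n. \<bar>\<alpha> j\<bar>)\<^sup>2"])
        have "(Fbar n \<omega> x)\<^sup>2 \<le> (\<Sum>j=1..N n. \<bar>\<alpha> j\<bar>)\<^sup>2" for x
          using power_mono[OF F_le[of x] abs_ge_zero, of 2] by simp
        then show "AE x in P. norm ((Fbar n \<omega> x)\<^sup>2) \<le> (\<Sum>j=1..N n. \<bar>\<alpha> j\<bar>)\<^sup>2" by simp
      qed (use F_meas in measurable)
      with F_meas have "Fbar n \<omega> \<in> L2 P" by (simp add: L2_def)
      then show ?thesis using Fstar by (auto simp: is_arg_min_def not_less)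
    qed
    then have "(\<integral>\<^sup>+\<omega>. ?R Fstar \<partial>M) \<le> (\<integral>\<^sup>+\<omega>. ?R (Fbar n \<omega>) \<partial>M)" by (intro nn_integral_mono)
    then show ?thesis by (simp add: emeasure_space_1)
  qed

  have finite_risk: "?R Fstar < \<top>"
  proof -
    have "(\<lambda>x. 0) \<in> L2 P" by (simp add: L2_def)
    then have "?R Fstar \<le> ?R (\<lambda>x. 0)" using Fstar by (auto simp: is_arg_min_def not_less)
    also have "\<dots> \<le> (\<integral>\<^sup>+\<omega>. ennreal \<phi>bar \<partial>M)"
      unfolding risk_def using \<phi>0 data_vals by (intro nn_integral_mono ennreal_leI) auto
    also have "\<dots> < \<top>" by (simp add: emeasure_space_1)
    finally show ?thesis .
  qed
  show ?thesis
  proof (rule order_tendstoI)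
    fix a assume a: "a < ?R Fstar"
    show "eventually (\<lambda>n. a < (\<integral>\<^sup>+\<omega>. ?R (Fbar n \<omega>) \<partial>M)) sequentially"
      using eventually_ge_at_top[of 1]
    proof eventually_elim
      case (elim n)
      show ?case by (rule less_le_trans[OF a lower[OF elim]])
    qed
  next
    fix a assume "?R Fstar < a"
    then obtain b where b: "?R Fstar < b" "b < a" using dense by blast
    obtain r where r: "?R Fstar = ennreal r" "r \<ge> 0"
      using finite_risk by (cases "?R Fstar") auto
    have "b < \<top>" using b(2) by (rule order_less_le_trans) simp
    then obtain s where s: "b = ennreal s" "s \<ge> 0" by (cases b) auto
    have rs: "r < s" using b(1) r s by (simp add: ennreal_less_iff)
    have sum: "?R Fstar + ennreal (s - r) = b"
      using r s rs by (simp add: ennreal_plus[symmetric] del: ennreal_plus)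
    have "eventually (\<lambda>n. (\<integral>\<^sup>+\<omega>. ?R (Fbar n \<omega>) \<partial>M) \<le> b) sequentially"
      using upper[of "s - r"] rs unfolding sum by simp
    then show "eventually (\<lambda>n. (\<integral>\<^sup>+\<omega>. ?R (Fbar n \<omega>) \<partial>M) < a) sequentially"
    proof eventually_elim
      case (elim n)
      then show ?case using b(2) by (rule le_less_trans)
    qed
  qed
qed

end
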